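(* In the message-passing model with $s$ players and edge duplication allowed, the communication cost of computing a multiplicative $2$-spanner of an $n$-vertex input graph is $\tilde\Theta(s n^2)$ bits.
   Context: Message-passing model: there are $s$ players $P^1,\dots,P^s$ and a coordinator. All parties know the vertex set $V$, $|V|=n$; player $P^i$ holds an edge set $E_i$ on $V$, and the input graph is $G=(V,\bigcup_i E_i)$ (unweighted, undirected). Communication is only between the coordinator and individual players; the coordinator must output the spanner. Communication cost is the total number of bits exchanged; randomized protocols must succeed with probability at least $2/3$ on every input. "With duplication" means the $E_i$ may overlap. A multiplicative $\alpha$-spanner of $G$ is a subgraph $H$ with $d_H(u,v)\le \alpha\, d_G(u,v)$ for all $u,v\in V$. $\tilde\Theta$ hides $\mathrm{poly}(\log n)$ factors. Standing assumption: $s\ll n$. *)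

theory Defs
  imports "HOL-Probability.Probability"
begin

section \<open>Graphs, distances and spanners\<close>

text \<open>A simple undirected graph on the vertex set \<open>{..<n}\<close> is given by its set of edges,
  each edge being an unordered pair of distinct vertices.\<close>

type_synonym edges = "nat set set"

definition all_edges :: "nat \<Rightarrow> edges" where
  "all_edges n = {{u, v} |u v. u < n \<and> v < n \<and> u \<noteq> v}"

definition walks :: "edges \<Rightarrow> nat \<Rightarrow> nat \<Rightarrow> nat list set" where
  "walks G u v =
     {p. p \<noteq> [] \<and> hd p = u \<and> last p = v \<and> successively (\<lambda>x y. {x, y} \<in> G) p}"

text \<open>The distance is \<open>\<infinity>\<close> if there is no walk (infimum of the empty set).\<close>

definition gdist :: "edges \<Rightarrow> nat \<Rightarrow> nat \<Rightarrow> enat" where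
  "gdist G u v = (INF p \<in> walks G u v. enat (length p - 1))"

definition is_spanner :: "real \<Rightarrow> nat \<Rightarrow> edges \<Rightarrow> edges \<Rightarrow> bool" where
  "is_spanner \<alpha> n G H \<longleftrightarrow> H \<subseteq> G \<and>
     (\<forall>u<n. \<forall>v<n. ereal_of_enat (gdist H u v) \<le> ereal \<alpha> * ereal_of_enat (gdist G u v))"

section \<open>The message-passing (coordinator) model\<close>

text \<open>The coordinator sees every exchanged bit, tagged with the player on whose channel it was
  sent. Player \<open>i\<close> sees only the bits on channel \<open>i\<close>.\<close>

type_synonym view = "(nat \<times> bool) list"

definition channel :: "nat \<Rightarrow> view \<Rightarrow> bool list" where
  "channel i t = map snd (filter (\<lambda>x. fst x = i) t)"

text \<open>A deterministic protocol. The coordinator has no input: from its view, \<open>next_player\<close>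
  chooses the channel used next (\<open>None\<close>: stop), \<open>coord_bit\<close> is the bit it sends if it is
  the sender on that channel, and \<open>result\<close> is the edge set it returns when it stops. A player's
  bit depends on its own edge set and on its own channel only. Which end of a channel sends the
  next bit is fixed by the bits already exchanged on that channel (\<open>coord_turn\<close>), so both ends
  know it and silence or the direction of a message carries no free information; this is the
  bit-by-bit form of communication with self-delimiting messages.\<close>

record protocol =
  next_player :: "view \<Rightarrow> nat option"
  coord_turn :: "nat \<Rightarrow> bool list \<Rightarrow> bool"
  coord_bit :: "view \<Rightarrow> bool"
  player_bit :: "nat \<Rightarrow> edges \<Rightarrow> bool list \<Rightarrow> bool"
  result :: "view \<Rightarrow> edges"

definition valid_protocol :: "nat \<Rightarrow> protocol \<Rightarrow> bool" where
  "valid_protocol s P \<longleftrightarrow> (\<forall>t i. next_player P t = Some i \<longrightarrow> i < s)"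

definition step :: "protocol \<Rightarrow> edges list \<Rightarrow> view \<Rightarrow> view" where
  "step P Es t = (case next_player P t of
       None \<Rightarrow> t
     | Some i \<Rightarrow> t @ [(i, if coord_turn P i (channel i t) then coord_bit P t
                         else player_bit P i (Es ! i) (channel i t))])"

text \<open>The view after at most \<open>m\<close> bits; it no longer changes once the coordinator has stopped.\<close>

definition transcript :: "protocol \<Rightarrow> edges list \<Rightarrow> nat \<Rightarrow> view" where
  "transcript P Es m = (step P Es ^^ m) []"

definition stops_within :: "protocol \<Rightarrow> edges list \<Rightarrow> nat \<Rightarrow> bool" where
  "stops_within P Es m \<longleftrightarrow> next_player P (transcript P Es m) = None"

text \<open>Player \<open>i\<close> holds \<open>Es ! i\<close>. The edge sets may overlap (duplication), and the input graph
  is their union.\<close>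

definition inputs :: "nat \<Rightarrow> nat \<Rightarrow> edges list set" where
  "inputs s n = {Es. length Es = s \<and> (\<forall>E\<in>set Es. E \<subseteq> all_edges n)}"

text \<open>A randomized protocol is a probability distribution on deterministic ones (shared
  randomness, which subsumes private coins). Its communication is bounded in the worst case, over
  inputs and coins. By the remark on \<open>transcript\<close>, \<open>transcript P Es m\<close> below is the final view.
  Discrete distributions lose no generality, since for fixed \<open>s\<close>, \<open>n\<close> and \<open>m\<close> there are only
  finitely many distinguishable deterministic behaviours.\<close>

definition computes_spanner :: "real \<Rightarrow> nat \<Rightarrow> nat \<Rightarrow> nat \<Rightarrow> protocol pmf \<Rightarrow> bool" where
  "computes_spanner \<alpha> s n m R \<longleftrightarrow>
     (\<forall>P\<in>set_pmf R. valid_protocol s P \<and> (\<forall>Es\<in>inputs s n. stops_within P Es m)) \<and>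
     (\<forall>Es\<in>inputs s n.
        measure_pmf.prob R {P. is_spanner \<alpha> n (\<Union>(set Es)) (result P (transcript P Es m))} \<ge> 2/3)"

definition spanner_comm_cost :: "real \<Rightarrow> nat \<Rightarrow> nat \<Rightarrow> enat" where
  "spanner_comm_cost \<alpha> s n = (INF m \<in> {m. \<exists>R. computes_spanner \<alpha> s n m R}. enat m)"

end

theory Submission
  imports Defs
begin

text \<open>A 2-spanner of a bipartite graph \<open>G\<close> is \<open>G\<close> itself, so the coordinator has to learn the union
  of \<open>s\<close> subsets of a set \<open>J\<close> of about \<open>n\<^sup>2/4\<close> edges. Let the players hold independent random
  subsets of a hidden set \<open>D \<subseteq> J\<close>. Adding to the input of player \<open>i\<close> an edge outside \<open>D\<close> must change the
  answer. Seen as a two-party conversation between player \<open>i\<close> and everybody else, channel \<open>i\<close> therefore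
  has to reveal, for every edge, either whether \<open>i\<close> holds it when it is in \<open>D\<close>, or whether it is in
  \<open>D\<close> when \<open>i\<close> does not hold it (as for set disjointness). This costs \<open>\<Omega>(|J|)\<close> bits on each of the
  \<open>s\<close> channels, under one common distribution, hence \<open>\<Omega>(s n\<^sup>2)\<close> in total, which sending
  everything matches up to a constant.\<close>

section \<open>Information inequalities\<close>

text \<open>A weak form of the sub-Gaussian bound \<open>cosh x \<le> exp (x\<^sup>2 / 2)\<close>:
  for \<open>0 \<le> y \<le> 1\<close> the two exponentials are at most
  \<open>1 + y + y\<^sup>2\<close> and \<open>1 - y + y\<^sup>2\<close>.\<close>

lemma exp_add_exp_minus_le:
  fixes x :: real
  assumes "\<bar>x\<bar> \<le> 1"
  shows "exp x + exp (- x) \<le> 2 * exp (x\<^sup>2)"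
proof -
  have *: "exp y + exp (- y) \<le> 2 * exp (y\<^sup>2)" if y: "0 \<le> y" "y \<le> 1" for y :: real
  proof -
    have "1 \<le> (1 - y + y\<^sup>2) * (1 + y)"
      using y by (simp add: algebra_simps power2_eq_square)
    then have "inverse (1 + y) \<le> 1 - y + y\<^sup>2"
      using y by (simp add: field_simps)
    moreover have "exp (- y) \<le> inverse (1 + y)"
      using y exp_ge_add_one_self[of y] by (simp add: exp_minus le_imp_inverse_le)
    moreover have "exp y \<le> 1 + y + y\<^sup>2" "1 + y\<^sup>2 \<le> exp (y\<^sup>2)"
      using y by (auto intro: exp_bound exp_ge_add_one_self)
    ultimately show ?thesis
      by linarith
  qed
  show ?thesis
    using assms *[of x] *[of "- x"] by (cases "0 \<le> x") auto
qed

text \<open>Up to the factor \<open>2 ^ card S\<close>, this is the moment generating function of a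
  sum of independent signs, which factorises.\<close>

lemma sum_Pow_exp_signed_sum:
  fixes l :: "'a \<Rightarrow> real"
  assumes "finite S"
  shows "(\<Sum>x\<in>Pow S. exp (\<Sum>j\<in>S. if j \<in> x then l j else - l j)) = (\<Prod>j\<in>S. exp (l j) + exp (- l j))"
proof -
  have "exp (\<Sum>j\<in>S. if j \<in> x then l j else - l j) = (\<Prod>j\<in>x. exp (l j)) * (\<Prod>j\<in>S - x. exp (- l j))"
    if "x \<in> Pow S" for x
  proof -
    have "(\<Sum>j\<in>S. if j \<in> x then l j else - l j) = (\<Sum>j\<in>x. l j) + (\<Sum>j\<in>S - x. - l j)"
      using that assms by (subst sum.subset_diff[of x S]) auto
    then show ?thesis
      using that assms by (simp add: exp_add exp_sum finite_subset[of x S] del: sum_negf)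
  qed
  then show ?thesis
    using assms by (simp add: prod_add)
qed

text \<open>A set of density \<open>2\<^sup>-\<^sup>k\<close> in the cube biases its coordinates by at most \<open>O(k)\<close> in
  total square: Jensen for \<open>exp\<close> under the density \<open>f / F\<close>, with weights proportional to the biases.\<close>

lemma sum_squared_biases_le:
  fixes f :: "'a set \<Rightarrow> real"
  assumes S: "finite S" and f: "\<And>x. x \<subseteq> S \<Longrightarrow> 0 \<le> f x" "\<And>x. x \<subseteq> S \<Longrightarrow> f x \<le> 1"
    and F: "F = (\<Sum>x\<in>Pow S. f x)" "F > 0"
    and d: "\<And>j. j \<in> S \<Longrightarrow> d j = (\<Sum>x\<in>Pow S. if j \<in> x then f x else - f x)"
  shows "(\<Sum>j\<in>S. (d j / F)\<^sup>2) \<le> 4 * ln (2 ^ card S / F)"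
proof -
  \<comment> \<open>With weights \<open>c * d j / F\<close> the mean of \<open>u\<close> is
    \<open>c * D\<close> and the exponent in the upper bound is \<open>c\<^sup>2 * D\<close>. The
    difference is largest, \<open>D / 4\<close>, at \<open>c = 1/2\<close>, whence the constant
    4.\<close>
  define l where "l j = d j / (2 * F)" for j
  define u where "u x = (\<Sum>j\<in>S. if j \<in> x then l j else - l j)" for x
  define D where "D = (\<Sum>j\<in>S. (d j / F)\<^sup>2)"
  have fin: "finite (Pow S)"
    using S by simp
  have l1: "\<bar>l j\<bar> \<le> 1" if "j \<in> S" for j
  proof -
    have "\<bar>d j\<bar> \<le> (\<Sum>x\<in>Pow S. f x)"
      unfolding d[OF that] by (rule order_trans[OF sum_abs sum_mono]) (use f in auto)
    then show ?thesis
      using F by (simp add: l_def abs_mult divide_le_eq abs_div)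
  qed
  have sumq: "(\<Sum>x\<in>Pow S. f x / F) = 1"
    using F by (simp add: sum_divide_distrib[symmetric])
  have "(\<Sum>x\<in>Pow S. f x / F * u x) = (\<Sum>x\<in>Pow S. \<Sum>j\<in>S. l j / F * (if j \<in> x then f x else - f x))"
    unfolding u_def sum_distrib_left by (intro sum.cong refl) auto
  also have "\<dots> = (\<Sum>j\<in>S. \<Sum>x\<in>Pow S. l j / F * (if j \<in> x then f x else - f x))"
    by (rule sum.swap)
  also have "\<dots> = (\<Sum>j\<in>S. l j / F * d j)"
    by (intro sum.cong refl) (simp only: d sum_distrib_left)
  also have "\<dots> = D / 2"
    unfolding D_def l_def sum_divide_distrib by (simp add: power2_eq_square mult_ac)
  finally have mean: "(\<Sum>x\<in>Pow S. f x / F * u x) = D / 2" .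
  have "exp (D / 2) \<le> (\<Sum>x\<in>Pow S. f x / F * exp (u x))"
    unfolding mean[symmetric]
    using convex_on_sum[OF fin _ exp_convex sumq, of u] f F by auto
  \<comment> \<open>Bounding \<open>f\<close> by 1 leaves the uniform measure on the cube, for which
    the sum factorises.\<close>
  also have "\<dots> \<le> (\<Sum>x\<in>Pow S. 1 / F * exp (u x))"
    using f F by (intro sum_mono mult_right_mono divide_right_mono) auto
  also have "\<dots> = (\<Prod>j\<in>S. exp (l j) + exp (- l j)) / F"
    using sum_Pow_exp_signed_sum[OF S, of l] by (simp add: u_def sum_divide_distrib[symmetric])
  also have "\<dots> \<le> (\<Prod>j\<in>S. 2 * exp ((l j)\<^sup>2)) / F"
    using F l1 by (intro divide_right_mono prod_mono)
      (auto intro!: exp_add_exp_minus_le add_nonneg_nonneg)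
  also have "\<dots> = 2 ^ card S / F * exp (\<Sum>j\<in>S. (l j)\<^sup>2)"
    using S by (simp add: prod.distrib exp_sum)
  also have "(\<Sum>j\<in>S. (l j)\<^sup>2) = D / 4"
    by (simp add: D_def l_def sum_divide_distrib power_divide power_mult_distrib mult_ac)
  finally have "D / 2 \<le> ln (2 ^ card S / F * exp (D / 4))"
    using F by (subst ln_ge_iff) auto
  also have "\<dots> = ln (2 ^ card S / F) + D / 4"
    using F by (subst ln_mult) auto
  finally show ?thesis
    by (simp add: D_def)
qed

text \<open>Of the weight \<open>2 powr - (2 * k + 1)\<close>, a factor \<open>2 powr - k\<close>
  pays for the number of strings of length \<open>k\<close>; the remaining
  \<open>2 powr - (k + 1)\<close> is summable over \<open>k\<close>. No prefix property
  enters.\<close>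

lemma sum_kraft_le:
  fixes T :: "bool list set"
  assumes "finite T"
  shows "(\<Sum>t\<in>T. (1/2) ^ (2 * length t + 1)) \<le> (1 :: real)"
proof -
  obtain m where m: "\<And>t. t \<in> T \<Longrightarrow> length t \<le> m"
    using assms by (metis finite_imageI finite_nat_set_iff_bounded_le imageI)
  define B where "B = (\<lambda>k. {t :: bool list. length t = k})"
  have B: "finite (B k)" "card (B k) = 2 ^ k" for k
    using finite_lists_length_eq[of "UNIV :: bool set" k] card_lists_length_eq[of "UNIV :: bool set" k]
    by (auto simp: B_def)
  have "(\<Sum>t\<in>T. (1/2 :: real) ^ (2 * length t + 1)) \<le> (\<Sum>t\<in>(\<Union>k\<in>{..m}. B k). (1/2) ^ (2 * length t + 1))"
    using m B by (intro sum_mono2) (auto simp: B_def)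
  also have "\<dots> = (\<Sum>k\<le>m. \<Sum>t\<in>B k. (1/2) ^ (2 * length t + 1))"
    using B by (intro sum.UNION_disjoint) (auto simp: B_def)
  also have "\<dots> = (\<Sum>k\<le>m. (1/2) ^ (k + 1))"
  proof (intro sum.cong refl)
    fix k
    have "(\<Sum>t\<in>B k. (1/2 :: real) ^ (2 * length t + 1)) = (\<Sum>t\<in>B k. (1/2) ^ (2 * k + 1))"
      by (intro sum.cong) (auto simp: B_def)
    also have "\<dots> = (2 ^ k * (1/2) ^ k) * (1/2) ^ (k + 1)"
      by (simp add: B mult_2 power_add)
    also have "2 ^ k * (1/2 :: real) ^ k = 1"
      by (simp flip: power_mult_distrib)
    finally show "(\<Sum>t\<in>B k. (1/2 :: real) ^ (2 * length t + 1)) = (1/2) ^ (k + 1)"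
      by simp
  qed
  also have "\<dots> = 1 - (1/2) ^ (m + 1)"
    by (induction m) auto
  finally show ?thesis
    using order_trans[of _ "1 - (1/2 :: real) ^ (m + 1)" 1] by simp
qed

text \<open>Gibbs' inequality against the weights \<open>2 powr - (2 |t| + 1)\<close>. The factor \<open>2\<close> in front of
  the length is needed because the strings do not form a prefix code: a player is not told when the
  communication on its channel is over.\<close>

lemma entropy_le_expected_length:
  fixes q :: "bool list \<Rightarrow> real"
  assumes T: "finite T" and q: "\<And>t. t \<in> T \<Longrightarrow> 0 \<le> q t" and M: "M = (\<Sum>t\<in>T. q t)"
  shows "(\<Sum>t\<in>T. q t * ln (M / q t)) \<le> (\<Sum>t\<in>T. q t * (2 * real (length t) + 1))"
proof (cases "M > 0")
  case False
  have "q t = 0" if "t \<in> T" for t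
    using False that sum_nonneg_0[OF T, of q] q M by (smt (verit) sum_nonneg)
  then show ?thesis
    by simp
next
  case True
  define Q :: "bool list \<Rightarrow> real" where "Q t = (1/2) ^ (2 * length t + 1)" for t
  have Q: "Q t > 0" "- ln (Q t) \<le> 2 * real (length t) + 1" for t
  proof -
    show "Q t > 0"
      by (simp add: Q_def)
    have "- ln (Q t) = real (2 * length t + 1) * ln 2"
      unfolding Q_def by (subst ln_realpow) (auto simp: ln_div)
    also have "\<dots> \<le> real (2 * length t + 1) * 1"
      using ln_2_less_1 by (intro mult_left_mono) auto
    finally show "- ln (Q t) \<le> 2 * real (length t) + 1"
      by simp
  qed
  \<comment> \<open>This is \<open>ln y \<le> y - 1\<close> for \<open>y = M * Q t / q t\<close>.
    The correction \<open>M * Q t - q t\<close> has sum at most 0, by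
    \<open>sum_kraft_le\<close>.\<close>
  have "q t * ln (M / q t) \<le> q t * (2 * real (length t) + 1) + (M * Q t - q t)" if t: "t \<in> T" for t
  proof (cases "q t = 0")
    case True
    then show ?thesis
      using \<open>M > 0\<close> Q(1)[of t] by simp
  next
    case False
    then have "q t > 0"
      using q[OF t] by simp
    then have "ln (M / q t) = ln (M * Q t / q t) - ln (Q t)"
      using Q(1)[of t] True by (simp add: ln_mult ln_div)
    also have "\<dots> \<le> (M * Q t / q t - 1) + (2 * real (length t) + 1)"
      using Q[of t] True \<open>q t > 0\<close> ln_le_minus_one[of "M * Q t / q t"] by auto
    finally have "q t * ln (M / q t) \<le> q t * ((M * Q t / q t - 1) + (2 * real (length t) + 1))"
      using \<open>q t > 0\<close> by (intro mult_left_mono) auto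
    then show ?thesis
      using \<open>q t > 0\<close> by (simp add: algebra_simps)
  qed
  then have "(\<Sum>t\<in>T. q t * ln (M / q t)) \<le> (\<Sum>t\<in>T. q t * (2 * real (length t) + 1) + (M * Q t - q t))"
    by (rule sum_mono)
  also have "\<dots> = (\<Sum>t\<in>T. q t * (2 * real (length t) + 1)) + (M * (\<Sum>t\<in>T. Q t) - M)"
    by (simp add: sum.distrib sum_subtractf M sum_distrib_left)
  also have "M * (\<Sum>t\<in>T. Q t) \<le> M * 1"
    using True sum_kraft_le[OF T] by (intro mult_left_mono) (auto simp: Q_def)
  finally show ?thesis
    by simp
qed

text \<open>Pointwise replacement for the cut-and-paste property of the Hellinger distance: if \<open>b1\<close> is not
  much smaller than \<open>b0\<close>, the left-hand side is controlled by the last two terms, and otherwise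
  \<open>a0 b0\<close> itself is controlled by the first one.\<close>

lemma cut_and_paste:
  fixes a0 a1 b0 b1 g :: real
  assumes nn: "0 \<le> a0" "0 \<le> a1" "0 \<le> b0" "0 \<le> b1" and g: "0 \<le> g" "g \<le> b0"
  shows "g * (a0 - a1) \<le> 6 * (a0 * (b0 + b1) * ((b1 - b0) / (b0 + b1))\<^sup>2) + b1 * (a0 + a1) / 12
           + 12 * (b1 * (a0 + a1) * ((a1 - a0) / (a0 + a1))\<^sup>2)"
proof (cases "a0 \<le> a1")
  case True
  then have "g * (a0 - a1) \<le> 0"
    using g by (simp add: mult_nonneg_nonpos)
  also have "0 \<le> 6 * (a0 * (b0 + b1) * ((b1 - b0) / (b0 + b1))\<^sup>2) + b1 * (a0 + a1) / 12
           + 12 * (b1 * (a0 + a1) * ((a1 - a0) / (a0 + a1))\<^sup>2)"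
    using nn by (intro add_nonneg_nonneg mult_nonneg_nonneg) auto
  finally show ?thesis .
next
  case False
  then have s: "a0 + a1 > 0"
    using nn by simp
  define e where "e = (a0 - a1) / (a0 + a1)"
  have e: "(a1 - a0) / (a0 + a1) = - e" "a0 - a1 = (a0 + a1) * e" "0 \<le> e"
    using s False by (auto simp: e_def field_simps)
  show ?thesis
  proof (cases "b0 \<le> 2 * b1")
    case True
    \<comment> \<open>The linear term is split so that the part free of information has coefficient
      \<open>1 / 12\<close>; in the end this loses half of the advantage guaranteed by
      correctness.\<close>
    have "0 \<le> (12 * e - 1)\<^sup>2"
      by simp
    then have *: "2 * e \<le> 1 / 12 + 12 * e\<^sup>2"
      by (simp add: power2_eq_square algebra_simps)
    have "g * (a0 - a1) \<le> (2 * b1) * (a0 - a1)"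
      using False g True by (intro mult_right_mono) auto
    also have "\<dots> = b1 * (a0 + a1) * (2 * e)"
      by (simp add: e)
    also have "\<dots> \<le> b1 * (a0 + a1) * (1 / 12 + 12 * e\<^sup>2)"
      using * nn by (intro mult_left_mono) auto
    also have "\<dots> = b1 * (a0 + a1) / 12 + 12 * (b1 * (a0 + a1) * ((a1 - a0) / (a0 + a1))\<^sup>2)"
      unfolding e by (simp add: algebra_simps)
    finally show ?thesis
      using nn by (smt (verit) mult_nonneg_nonneg zero_le_power2)
  next
    case b: False
    then have p: "b0 + b1 > 0"
      using nn by simp
    \<comment> \<open>From \<open>b1 < b0 / 2\<close> it follows that
      \<open>b0 + b1 \<le> 3 / 2 * b0\<close> and \<open>b0 - b1 \<ge> b0 / 2\<close>; the 6 is
      \<open>3 / 2\<close> times 4.\<close>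
    have "b0 * (b0 + b1) \<le> 6 * (b1 - b0)\<^sup>2"
    proof -
      have "(b0 / 2)\<^sup>2 \<le> (b0 - b1)\<^sup>2"
        using b nn by (intro power_mono) auto
      moreover have "b0 * (b0 + b1) \<le> b0 * (3 / 2 * b0)"
        using b nn by (intro mult_left_mono) auto
      ultimately show ?thesis
        by (simp add: power2_eq_square algebra_simps)
    qed
    then have "b0 \<le> 6 * ((b0 + b1) * ((b1 - b0) / (b0 + b1))\<^sup>2)"
      using p by (simp add: power_divide power2_eq_square[of "b0 + b1"] pos_le_divide_eq)
    then have "a0 * b0 \<le> a0 * (6 * ((b0 + b1) * ((b1 - b0) / (b0 + b1))\<^sup>2))"
      using nn by (intro mult_left_mono) auto
    moreover have "g * (a0 - a1) \<le> b0 * a0"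
      using nn g False by (intro mult_mono) auto
    moreover have "0 \<le> b1 * (a0 + a1) / 12 + 12 * (b1 * (a0 + a1) * ((a1 - a0) / (a0 + a1))\<^sup>2)"
      using nn by (intro add_nonneg_nonneg mult_nonneg_nonneg) auto
    ultimately show ?thesis
      by (simp add: mult_ac)
  qed
qed

section \<open>Two-party rectangles\<close>

lemma sum_Pow_insert:
  fixes f :: "'a set \<Rightarrow> 'b :: comm_monoid_add"
  assumes "finite C" "j \<notin> C"
  shows "(\<Sum>x\<in>Pow (insert j C). f x) = (\<Sum>x\<in>Pow C. f x) + (\<Sum>x\<in>Pow C. f (insert j x))"
proof -
  have "inj_on (insert j) (Pow C)"
    using assms by (auto simp: inj_on_def)
  then have "(\<Sum>x\<in>insert j ` Pow C. f x) = (\<Sum>x\<in>Pow C. f (insert j x))"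
    by (simp add: sum.reindex)
  moreover have "Pow C \<inter> insert j ` Pow C = {}"
    using assms by auto
  ultimately show ?thesis
    using assms by (simp add: Pow_insert sum.union_disjoint)
qed

text \<open>Pairs of \<open>A\<close> and \<open>j\<close> are regrouped by
  \<open>C = A - {j}\<close>. The coordinate \<open>j\<close> belongs to Alice for
  \<open>A = insert j C\<close> and to Bob for \<open>A = C\<close>, the two cases that
  \<open>coordinate_advantage_le\<close> combines.\<close>

lemma sum_Pow_element_swap:
  fixes f g :: "'a set \<Rightarrow> 'a \<Rightarrow> real"
  assumes J: "finite J"
  shows "(\<Sum>A\<in>Pow J. (\<Sum>j\<in>A. f A j) + (\<Sum>j\<in>J - A. g A j))
       = (\<Sum>j\<in>J. \<Sum>C\<in>Pow (J - {j}). f (insert j C) j + g C j)"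
proof -
  have "(\<Sum>A\<in>Pow J. (\<Sum>j\<in>A. f A j) + (\<Sum>j\<in>J - A. g A j))
      = (\<Sum>A\<in>Pow J. \<Sum>j\<in>J. if j \<in> A then f A j else g A j)"
  proof (intro sum.cong refl)
    fix A assume "A \<in> Pow J"
    then have "(\<Sum>j\<in>J. if j \<in> A then f A j else g A j)
        = (\<Sum>j\<in>J - A. if j \<in> A then f A j else g A j) + (\<Sum>j\<in>A. if j \<in> A then f A j else g A j)"
      using J by (intro sum.subset_diff) auto
    then show "(\<Sum>j\<in>A. f A j) + (\<Sum>j\<in>J - A. g A j) = (\<Sum>j\<in>J. if j \<in> A then f A j else g A j)"
      by (simp add: add.commute)
  qed
  also have "\<dots> = (\<Sum>j\<in>J. \<Sum>A\<in>Pow J. if j \<in> A then f A j else g A j)"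
    by (rule sum.swap)
  also have "\<dots> = (\<Sum>j\<in>J. \<Sum>C\<in>Pow (J - {j}). f (insert j C) j + g C j)"
  proof (rule sum.cong[OF refl])
    fix j assume j: "j \<in> J"
    have "(\<Sum>A\<in>Pow (insert j (J - {j})). if j \<in> A then f A j else g A j)
        = (\<Sum>C\<in>Pow (J - {j}). if j \<in> C then f C j else g C j) + (\<Sum>C\<in>Pow (J - {j}). f (insert j C) j)"
      using J by (subst sum_Pow_insert) auto
    also have "(\<Sum>C\<in>Pow (J - {j}). if j \<in> C then f C j else g C j) = (\<Sum>C\<in>Pow (J - {j}). g C j)"
      by (intro sum.cong) auto
    finally show "(\<Sum>A\<in>Pow J. if j \<in> A then f A j else g A j)
        = (\<Sum>C\<in>Pow (J - {j}). f (insert j C) j + g C j)"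
      using j by (simp add: insert_absorb sum.distrib add.commute)
  qed
  finally show ?thesis .
qed

lemma sum_bilinear:
  fixes u :: "'x \<Rightarrow> 't \<Rightarrow> real"
  shows "(\<Sum>t\<in>T. (\<Sum>x\<in>X. u x t) * (\<Sum>F\<in>Y. \<Sum>r\<in>R. k F r * v r t))
       = (\<Sum>x\<in>X. \<Sum>F\<in>Y. \<Sum>r\<in>R. k F r * (\<Sum>t\<in>T. u x t * v r t))"
proof -
  have "(\<Sum>t\<in>T. (\<Sum>x\<in>X. u x t) * (\<Sum>F\<in>Y. \<Sum>r\<in>R. k F r * v r t))
      = (\<Sum>t\<in>T. \<Sum>x\<in>X. \<Sum>F\<in>Y. \<Sum>r\<in>R. k F r * (u x t * v r t))"
    by (rule sum.cong[OF refl], subst sum_distrib_right) (simp add: sum_distrib_left mult_ac)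
  also have "\<dots> = (\<Sum>x\<in>X. \<Sum>t\<in>T. \<Sum>F\<in>Y. \<Sum>r\<in>R. k F r * (u x t * v r t))"
    by (rule sum.swap)
  also have "\<dots> = (\<Sum>x\<in>X. \<Sum>F\<in>Y. \<Sum>t\<in>T. \<Sum>r\<in>R. k F r * (u x t * v r t))"
    by (intro sum.cong refl sum.swap)
  also have "\<dots> = (\<Sum>x\<in>X. \<Sum>F\<in>Y. \<Sum>r\<in>R. \<Sum>t\<in>T. k F r * (u x t * v r t))"
    by (intro sum.cong refl sum.swap)
  finally show ?thesis
    by (simp add: sum_distrib_left)
qed

text \<open>Alice holds \<open>x \<subseteq> J\<close>, Bob holds \<open>r\<close>, drawn from \<open>\<kappa> D\<close> for some hidden \<open>D \<subseteq> J\<close>; \<open>\<tau>\<close> is the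
  transcript between them and \<open>out\<close> is what Bob returns. Conditioned on a set \<open>A\<close>, the bits of
  \<open>x \<subseteq> A\<close> and of \<open>D - A\<close> (where \<open>A \<subseteq> D\<close>) are independent and uniform, so \<open>x \<subseteq> D\<close> always,
  yet each coordinate reveals something about \<open>x\<close> or about \<open>D\<close>.\<close>

locale rectangle_channel =
  fixes J :: "'a set" and Rs :: "'r set" and \<kappa> :: "'a set \<Rightarrow> 'r \<Rightarrow> real"
    and \<tau> :: "'a set \<Rightarrow> 'r \<Rightarrow> bool list" and out :: "'a set \<Rightarrow> 'r \<Rightarrow> 'a set"
  assumes finite_J: "finite J" and finite_Rs: "finite Rs"
    and \<kappa>_nonneg: "\<And>D r. 0 \<le> \<kappa> D r"
    and \<kappa>_sum: "\<And>D. D \<subseteq> J \<Longrightarrow> (\<Sum>r\<in>Rs. \<kappa> D r) = 1"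
    and rectangle: "\<And>x x' r r'. \<lbrakk>x \<subseteq> J; x' \<subseteq> J; r \<in> Rs; r' \<in> Rs; \<tau> x r = \<tau> x' r'\<rbrakk>
          \<Longrightarrow> \<tau> x' r = \<tau> x r \<and> out x' r = out x r"
begin

definition T where "T = (\<lambda>(x, r). \<tau> x r) ` (Pow J \<times> Rs)"

text \<open>Every transcript occurs on a product set; \<open>a\<close> and \<open>b\<close> are the
  indicators of its two sides.\<close>

definition a :: "'a set \<Rightarrow> bool list \<Rightarrow> real" where
  "a x t = of_bool (\<exists>r\<in>Rs. \<tau> x r = t)"

definition b :: "'r \<Rightarrow> bool list \<Rightarrow> real" where
  "b r t = of_bool (\<exists>x\<subseteq>J. \<tau> x r = t)"

text \<open>Once the transcript is fixed, the output depends on \<open>r\<close> alone, so missing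
  \<open>j\<close> is a property of Bob's side.\<close>

definition b_miss :: "'a \<Rightarrow> 'r \<Rightarrow> bool list \<Rightarrow> real" where
  "b_miss j r t = of_bool (\<exists>x\<subseteq>J. \<tau> x r = t \<and> j \<notin> out x r)"

definition alice :: "'a set \<Rightarrow> bool list \<Rightarrow> real" where
  "alice A t = (\<Sum>x\<in>Pow A. a x t)"

definition bob1 :: "'a set \<Rightarrow> bool list \<Rightarrow> real" where
  "bob1 D t = (\<Sum>r\<in>Rs. \<kappa> D r * b r t)"

definition bob :: "'a set \<Rightarrow> bool list \<Rightarrow> real" where
  "bob A t = (\<Sum>F\<in>Pow (J - A). bob1 (A \<union> F) t)"

definition alice_bias :: "'a set \<Rightarrow> 'a \<Rightarrow> bool list \<Rightarrow> real" where
  "alice_bias A j t = (\<Sum>x\<in>Pow A. if j \<in> x then a x t else - a x t)"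

definition bob_bias :: "'a set \<Rightarrow> 'a \<Rightarrow> bool list \<Rightarrow> real" where
  "bob_bias A j t = (\<Sum>F\<in>Pow (J - A). if j \<in> F then bob1 (A \<union> F) t else - bob1 (A \<union> F) t)"

text \<open>Given \<open>A\<close>, and up to the factor \<open>2 ^ card J\<close>, the mean square
  of the bias that the transcript gives to bit \<open>j\<close> of \<open>x\<close>: a quadratic
  stand-in for mutual information. If \<open>alice A t = 0\<close>, the summand vanishes with its
  weight.\<close>

definition alice_info :: "'a set \<Rightarrow> 'a \<Rightarrow> real" where
  "alice_info A j = (\<Sum>t\<in>T. bob A t * alice A t * (alice_bias A j t / alice A t)\<^sup>2)"

definition bob_info :: "'a set \<Rightarrow> 'a \<Rightarrow> real" where
  "bob_info A j = (\<Sum>t\<in>T. alice A t * bob A t * (bob_bias A j t / bob A t)\<^sup>2)"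

lemma finite_T: "finite T"
  by (simp add: T_def finite_J finite_Rs)

lemma finite_sub: "A \<subseteq> J \<Longrightarrow> finite A"
  using finite_J finite_subset by blast

lemma a_b:
  assumes "x \<subseteq> J" "r \<in> Rs"
  shows "a x t * b r t = of_bool (\<tau> x r = t)"
proof -
  have "\<tau> x r = t" if "r' \<in> Rs" "\<tau> x r' = t" "x' \<subseteq> J" "\<tau> x' r = t" for x' r'
    using rectangle[of x' x r r'] assms that by simp
  then have "(\<exists>r\<in>Rs. \<tau> x r = t) \<and> (\<exists>x\<subseteq>J. \<tau> x r = t) \<longleftrightarrow> \<tau> x r = t"
    using assms by blast
  then show ?thesis
    unfolding a_def b_def of_bool_conj[symmetric] by simp
qed

lemma a_b_miss:
  assumes "x \<subseteq> J" "r \<in> Rs"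
  shows "a x t * b_miss j r t = of_bool (\<tau> x r = t \<and> j \<notin> out x r)"
proof -
  have "\<tau> x r = t \<and> j \<notin> out x r"
    if "r' \<in> Rs" "\<tau> x r' = t" "x' \<subseteq> J" "\<tau> x' r = t" "j \<notin> out x' r" for x' r'
    using rectangle[of x' x r r'] assms that by simp
  then have "(\<exists>r\<in>Rs. \<tau> x r = t) \<and> (\<exists>x\<subseteq>J. \<tau> x r = t \<and> j \<notin> out x r)
      \<longleftrightarrow> \<tau> x r = t \<and> j \<notin> out x r"
    using assms by blast
  then show ?thesis
    unfolding a_def b_miss_def of_bool_conj[symmetric] by simp
qed

lemma in_T: "\<lbrakk>x \<subseteq> J; r \<in> Rs\<rbrakk> \<Longrightarrow> \<tau> x r \<in> T"
  by (auto simp: T_def)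

text \<open>Given \<open>A\<close>, the product \<open>alice A t * bob A t\<close> is
  \<open>2 ^ card J\<close> times the probability of \<open>t\<close>, so sums against it are
  expectations.\<close>

lemma sum_T:
  assumes "A \<subseteq> J"
  shows "(\<Sum>t\<in>T. alice A t * bob A t * \<phi> t)
       = (\<Sum>x\<in>Pow A. \<Sum>F\<in>Pow (J - A). \<Sum>r\<in>Rs. \<kappa> (A \<union> F) r * \<phi> (\<tau> x r))"
proof -
  have "(\<Sum>t\<in>T. alice A t * bob A t * \<phi> t)
      = (\<Sum>t\<in>T. (\<Sum>x\<in>Pow A. a x t) * (\<Sum>F\<in>Pow (J - A). \<Sum>r\<in>Rs. \<kappa> (A \<union> F) r * (b r t * \<phi> t)))"
    by (simp add: alice_def bob_def bob1_def sum_distrib_right mult.assoc)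
  also have "\<dots> = (\<Sum>x\<in>Pow A. \<Sum>F\<in>Pow (J - A). \<Sum>r\<in>Rs. \<kappa> (A \<union> F) r * (\<Sum>t\<in>T. a x t * (b r t * \<phi> t)))"
    by (rule sum_bilinear)
  also have "\<dots> = (\<Sum>x\<in>Pow A. \<Sum>F\<in>Pow (J - A). \<Sum>r\<in>Rs. \<kappa> (A \<union> F) r * \<phi> (\<tau> x r))"
  proof (intro sum.cong refl arg_cong2[where f = "(*)"])
    fix x r assume "x \<in> Pow A" "r \<in> Rs"
    then have xr: "x \<subseteq> J" "r \<in> Rs"
      using assms by auto
    have "(\<Sum>t\<in>T. a x t * (b r t * \<phi> t)) = (\<Sum>t\<in>T. if t = \<tau> x r then \<phi> t else 0)"
      using a_b[OF xr] by (intro sum.cong refl) (auto simp flip: mult.assoc)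
    then show "(\<Sum>t\<in>T. a x t * (b r t * \<phi> t)) = \<phi> (\<tau> x r)"
      using in_T[OF xr] finite_T by simp
  qed
  finally show ?thesis .
qed

lemma sum_T_one:
  assumes "A \<subseteq> J"
  shows "(\<Sum>t\<in>T. alice A t * bob A t) = 2 ^ card J"
proof -
  have "(\<Sum>t\<in>T. alice A t * bob A t) = (\<Sum>x\<in>Pow A. \<Sum>F\<in>Pow (J - A). \<Sum>r\<in>Rs. \<kappa> (A \<union> F) r)"
    using sum_T[OF assms, of "\<lambda>_. 1"] by simp
  also have "\<dots> = (\<Sum>x\<in>Pow A. \<Sum>F\<in>Pow (J - A). 1)"
    using assms by (intro sum.cong refl \<kappa>_sum) auto
  also have "\<dots> = 2 ^ (card A + card (J - A))"
    using assms finite_sub[OF assms] finite_J by (simp add: card_Pow power_add)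
  also have "card A + card (J - A) = card J"
    using assms finite_J finite_sub[OF assms] by (simp add: card_Diff_subset card_mono)
  finally show ?thesis .
qed

lemma bob1_bounds: "D \<subseteq> J \<Longrightarrow> 0 \<le> bob1 D t \<and> bob1 D t \<le> 1"
proof -
  assume D: "D \<subseteq> J"
  have "bob1 D t \<le> (\<Sum>r\<in>Rs. \<kappa> D r)"
    unfolding bob1_def by (intro sum_mono) (auto simp: b_def \<kappa>_nonneg)
  then show ?thesis
    using \<kappa>_sum[OF D] by (auto simp: bob1_def b_def \<kappa>_nonneg intro!: sum_nonneg)
qed

lemma bob1_Un_bounds:
  assumes "A \<subseteq> J" "F \<subseteq> J - A"
  shows "0 \<le> bob1 (A \<union> F) t" "bob1 (A \<union> F) t \<le> 1"
  using assms bob1_bounds[of "A \<union> F" t] by auto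

lemma alice_nonneg: "0 \<le> alice A t"
  by (auto simp: alice_def a_def intro!: sum_nonneg)

lemma bob_nonneg: "A \<subseteq> J \<Longrightarrow> 0 \<le> bob A t"
  unfolding bob_def by (intro sum_nonneg) (use bob1_Un_bounds in auto)

lemma bob_info_nonneg:
  assumes "A \<subseteq> J"
  shows "0 \<le> bob_info A j"
  unfolding bob_info_def
  by (auto intro!: sum_nonneg mult_nonneg_nonneg alice_nonneg bob_nonneg assms)

text \<open>Given \<open>t\<close>, the squared biases on either side are bounded by the logarithm
  of the inverse density of that side. As the weight of \<open>t\<close> is a product, the two
  logarithms add up to that of the inverse probability of \<open>t\<close>, whose mean is the
  entropy of the transcript.\<close>

lemma info_le_length:
  assumes A: "A \<subseteq> J"
  shows "(\<Sum>j\<in>A. alice_info A j) + (\<Sum>j\<in>J - A. bob_info A j)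
       \<le> 4 * (\<Sum>x\<in>Pow A. \<Sum>F\<in>Pow (J - A). \<Sum>r\<in>Rs. \<kappa> (A \<union> F) r * (2 * real (length (\<tau> x r)) + 1))"
proof -
  define q where "q t = alice A t * bob A t" for t
  have fin: "finite A" "finite (J - A)"
    using A finite_J finite_sub by auto
  have q: "0 \<le> q t" for t
    by (simp add: q_def alice_nonneg bob_nonneg A)
  have card: "card A + card (J - A) = card J"
    using A finite_J fin by (simp add: card_Diff_subset card_mono)
  have pt: "q t * ((\<Sum>j\<in>A. (alice_bias A j t / alice A t)\<^sup>2) + (\<Sum>j\<in>J - A. (bob_bias A j t / bob A t)\<^sup>2))
      \<le> 4 * (q t * ln (2 ^ card J / q t))" for t
  proof (cases "q t = 0")
    case False
    then have pos: "alice A t > 0" "bob A t > 0"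
      using alice_nonneg[of A t] bob_nonneg[OF A, of t] by (auto simp: q_def less_le)
    have "(\<Sum>j\<in>A. (alice_bias A j t / alice A t)\<^sup>2) \<le> 4 * ln (2 ^ card A / alice A t)"
      by (rule sum_squared_biases_le[where f = "\<lambda>x. a x t"])
        (use fin pos in \<open>auto simp: a_def alice_def alice_bias_def\<close>)
    moreover have "(\<Sum>j\<in>J - A. (bob_bias A j t / bob A t)\<^sup>2) \<le> 4 * ln (2 ^ card (J - A) / bob A t)"
      by (rule sum_squared_biases_le[where f = "\<lambda>F. bob1 (A \<union> F) t"])
        (use fin pos bob1_Un_bounds[OF A] in \<open>auto simp: bob_def bob_bias_def\<close>)
    moreover have "ln (2 ^ card J / q t) = ln (2 ^ card A / alice A t) + ln (2 ^ card (J - A) / bob A t)"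
      using pos unfolding card[symmetric] q_def by (simp add: ln_div ln_mult power_add)
    ultimately have "(\<Sum>j\<in>A. (alice_bias A j t / alice A t)\<^sup>2) + (\<Sum>j\<in>J - A. (bob_bias A j t / bob A t)\<^sup>2)
        \<le> 4 * ln (2 ^ card J / q t)"
      by linarith
    then have "q t * ((\<Sum>j\<in>A. (alice_bias A j t / alice A t)\<^sup>2) + (\<Sum>j\<in>J - A. (bob_bias A j t / bob A t)\<^sup>2))
        \<le> q t * (4 * ln (2 ^ card J / q t))"
      using q by (rule mult_left_mono)
    then show ?thesis
      by simp
  qed auto
  have "(\<Sum>j\<in>A. alice_info A j) + (\<Sum>j\<in>J - A. bob_info A j)
      = (\<Sum>t\<in>T. q t * ((\<Sum>j\<in>A. (alice_bias A j t / alice A t)\<^sup>2) + (\<Sum>j\<in>J - A. (bob_bias A j t / bob A t)\<^sup>2)))"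
    unfolding alice_info_def bob_info_def sum.swap[of _ T] q_def
    by (simp add: sum_distrib_left distrib_left sum.distrib mult_ac)
  also have "\<dots> \<le> (\<Sum>t\<in>T. 4 * (q t * ln (2 ^ card J / q t)))"
    by (intro sum_mono pt)
  also have "\<dots> = 4 * (\<Sum>t\<in>T. q t * ln (2 ^ card J / q t))"
    by (simp add: sum_distrib_left)
  also have "\<dots> \<le> 4 * (\<Sum>t\<in>T. q t * (2 * real (length t) + 1))"
    using entropy_le_expected_length[OF finite_T, of q "2 ^ card J"] q sum_T_one[OF A]
    by (simp add: q_def)
  also have "(\<Sum>t\<in>T. q t * (2 * real (length t) + 1))
      = (\<Sum>x\<in>Pow A. \<Sum>F\<in>Pow (J - A). \<Sum>r\<in>Rs. \<kappa> (A \<union> F) r * (2 * real (length (\<tau> x r)) + 1))"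
    unfolding q_def by (rule sum_T[OF A])
  finally show ?thesis .
qed

text \<open>The indices 0 and 1 tell whether \<open>j\<close> is in \<open>x\<close> (for
  \<open>a0\<close>, \<open>a1\<close>) or in \<open>D\<close> (for \<open>b0\<close>,
  \<open>b1\<close>). The combination of \<open>a1\<close> with \<open>b0\<close> has probability 0
  in the distribution, as \<open>x \<subseteq> D\<close>. It is reached through the other three:
  Alice's information compares \<open>a0\<close> with \<open>a1\<close> when \<open>j\<close> is in
  \<open>D\<close>, and Bob's compares \<open>b0\<close> with \<open>b1\<close> when
  \<open>j\<close> is not in \<open>x\<close>.\<close>

lemma coordinate_advantage_le:
  assumes j: "j \<in> J" and C: "C \<subseteq> J - {j}"
  shows "(\<Sum>x\<in>Pow C. \<Sum>F\<in>Pow (J - {j} - C). \<Sum>r\<in>Rs.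
            \<kappa> (C \<union> F) r * (of_bool (j \<notin> out x r) - of_bool (j \<notin> out (insert j x) r)))
       \<le> 2 ^ card J / 12 + 12 * (alice_info (insert j C) j + bob_info C j)" (is "?L \<le> _")
proof -
  define a0 where "a0 t = (\<Sum>x\<in>Pow C. a x t)" for t
  define a1 where "a1 t = (\<Sum>x\<in>Pow C. a (insert j x) t)" for t
  define B where "B = J - {j} - C"
  define b0 where "b0 t = (\<Sum>F\<in>Pow B. bob1 (C \<union> F) t)" for t
  define b1 where "b1 t = (\<Sum>F\<in>Pow B. bob1 (insert j (C \<union> F)) t)" for t
  define g where "g t = (\<Sum>F\<in>Pow B. \<Sum>r\<in>Rs. \<kappa> (C \<union> F) r * b_miss j r t)" for t
  have CJ: "C \<subseteq> J" "insert j C \<subseteq> J" "j \<notin> C" "J - C = insert j B" "J - insert j C = B" "j \<notin> B"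
      "finite C" "finite B" "B \<subseteq> J"
    using C j finite_J finite_sub by (auto simp: B_def)
  have nj: "j \<notin> x" if "x \<in> Pow C \<or> x \<in> Pow B" for x
    using that CJ by auto
  have sub: "C \<union> F \<subseteq> J" "insert j (C \<union> F) \<subseteq> J" if "F \<in> Pow B" for F
    using that CJ(1,2,9) by blast+
  have alice: "alice C t = a0 t" "alice (insert j C) t = a0 t + a1 t"
      "alice_bias (insert j C) j t = a1 t - a0 t" for t
    using CJ nj by (simp_all add: alice_def alice_bias_def a0_def a1_def sum_Pow_insert sum_negf)
  have bob: "bob C t = b0 t + b1 t" "bob (insert j C) t = b1 t" "bob_bias C j t = b1 t - b0 t" for t
    using CJ nj by (simp_all add: bob_def bob_bias_def b0_def b1_def sum_Pow_insert sum_negf)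
  have nn: "0 \<le> a0 t" "0 \<le> a1 t" "0 \<le> b0 t" "0 \<le> b1 t" "0 \<le> g t" "g t \<le> b0 t" for t
  proof -
    show "0 \<le> a0 t" "0 \<le> a1 t" "0 \<le> g t"
      by (auto simp: a0_def a1_def g_def a_def b_miss_def \<kappa>_nonneg intro!: sum_nonneg)
    show "0 \<le> b0 t" "0 \<le> b1 t"
      unfolding b0_def b1_def by (intro sum_nonneg conjunct1[OF bob1_bounds] sub; assumption)+
    show "g t \<le> b0 t"
      unfolding g_def b0_def bob1_def
      by (intro sum_mono mult_left_mono \<kappa>_nonneg) (auto simp: b_def b_miss_def)
  qed
  have miss: "(\<Sum>t\<in>T. a x t * b_miss j r t) = of_bool (j \<notin> out x r)" if "x \<subseteq> J" "r \<in> Rs" for x r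
  proof -
    have "(\<Sum>t\<in>T. a x t * b_miss j r t) = (\<Sum>t\<in>T. if t = \<tau> x r then of_bool (j \<notin> out x r) else 0)"
      by (intro sum.cong refl) (auto simp: a_b_miss[OF that])
    then show ?thesis
      using in_T[OF that] finite_T by simp
  qed
  have "(\<Sum>t\<in>T. a0 t * g t) = (\<Sum>x\<in>Pow C. \<Sum>F\<in>Pow B. \<Sum>r\<in>Rs. \<kappa> (C \<union> F) r * of_bool (j \<notin> out x r))"
    unfolding a0_def g_def sum_bilinear using CJ miss by (intro sum.cong refl) auto
  moreover have "(\<Sum>t\<in>T. a1 t * g t)
      = (\<Sum>x\<in>Pow C. \<Sum>F\<in>Pow B. \<Sum>r\<in>Rs. \<kappa> (C \<union> F) r * of_bool (j \<notin> out (insert j x) r))"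
    unfolding a1_def g_def sum_bilinear using CJ miss by (intro sum.cong refl) auto
  ultimately have "?L = (\<Sum>t\<in>T. g t * (a0 t - a1 t))"
    by (simp add: B_def[symmetric] right_diff_distrib sum_subtractf mult.commute)
  also have "\<dots> \<le> (\<Sum>t\<in>T. 6 * (a0 t * (b0 t + b1 t) * ((b1 t - b0 t) / (b0 t + b1 t))\<^sup>2)
      + b1 t * (a0 t + a1 t) / 12 + 12 * (b1 t * (a0 t + a1 t) * ((a1 t - a0 t) / (a0 t + a1 t))\<^sup>2))"
    by (intro sum_mono cut_and_paste nn)
  also have "\<dots> = 6 * bob_info C j + (\<Sum>t\<in>T. alice (insert j C) t * bob (insert j C) t) / 12
      + 12 * alice_info (insert j C) j"
    by (simp add: bob_info_def alice_info_def alice bob sum.distrib sum_distrib_left sum_divide_distrib mult_ac)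
  \<comment> \<open>Raising 6 to 12 gives both informations the same coefficient, so that they
    regroup by \<open>sum_Pow_element_swap\<close>.\<close>
  also have "\<dots> \<le> 2 ^ card J / 12 + 12 * (alice_info (insert j C) j + bob_info C j)"
    using bob_info_nonneg[OF CJ(1), of j] by (simp add: sum_T_one[OF CJ(2)])
  finally show ?thesis .
qed

text \<open>The factor 48 is the 12 of each coordinate times the 4 of \<open>info_le_length\<close>;
  the \<open>2 ^ (card J - 1)\<close> sets \<open>C\<close> turn \<open>2 ^ card J / 12\<close> into
  \<open>4 ^ card J / 24\<close>.\<close>

lemma total_advantage_le:
  "(\<Sum>j\<in>J. \<Sum>C\<in>Pow (J - {j}). \<Sum>x\<in>Pow C. \<Sum>F\<in>Pow (J - {j} - C). \<Sum>r\<in>Rs.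
      \<kappa> (C \<union> F) r * (of_bool (j \<notin> out x r) - of_bool (j \<notin> out (insert j x) r)))
   \<le> real (card J) * 4 ^ card J / 24
      + 48 * (\<Sum>A\<in>Pow J. \<Sum>x\<in>Pow A. \<Sum>F\<in>Pow (J - A). \<Sum>r\<in>Rs. \<kappa> (A \<union> F) r * (2 * real (length (\<tau> x r)) + 1))"
  (is "?L \<le> _ + 48 * ?E")
proof -
  have "?L \<le> (\<Sum>j\<in>J. \<Sum>C\<in>Pow (J - {j}). 2 ^ card J / 12 + 12 * (alice_info (insert j C) j + bob_info C j))"
    by (intro sum_mono coordinate_advantage_le) auto
  also have "\<dots> = (\<Sum>j\<in>J. \<Sum>C\<in>Pow (J - {j}). 2 ^ card J / 12)
      + 12 * (\<Sum>j\<in>J. \<Sum>C\<in>Pow (J - {j}). alice_info (insert j C) j + bob_info C j)"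
    by (simp add: sum.distrib sum_distrib_left algebra_simps)
  also have "(\<Sum>j\<in>J. \<Sum>C\<in>Pow (J - {j}). 2 ^ card J / (12 :: real)) = (\<Sum>j\<in>J. 4 ^ card J / 24)"
  proof (intro sum.cong refl)
    fix j assume j: "j \<in> J"
    then have "card J = Suc (card (J - {j}))"
      using finite_J by (metis card_Suc_Diff1)
    then have "(2 :: real) ^ card J = 2 * 2 ^ card (J - {j})"
      by simp
    moreover have "(4 :: real) ^ card J = 2 ^ card J * 2 ^ card J"
      by (simp flip: power_mult_distrib)
    ultimately show "(\<Sum>C\<in>Pow (J - {j}). 2 ^ card J / (12 :: real)) = 4 ^ card J / 24"
      using finite_J by (simp add: card_Pow)
  qed
  also have "(\<Sum>j\<in>J. \<Sum>C\<in>Pow (J - {j}). alice_info (insert j C) j + bob_info C j)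
      = (\<Sum>A\<in>Pow J. (\<Sum>j\<in>A. alice_info A j) + (\<Sum>j\<in>J - A. bob_info A j))"
    by (rule sum_Pow_element_swap[OF finite_J, symmetric])
  also have "\<dots> \<le> (\<Sum>A\<in>Pow J. 4 * (\<Sum>x\<in>Pow A. \<Sum>F\<in>Pow (J - A). \<Sum>r\<in>Rs.
      \<kappa> (A \<union> F) r * (2 * real (length (\<tau> x r)) + 1)))"
    by (intro sum_mono info_le_length) auto
  also have "\<dots> = 4 * ?E"
    by (simp add: sum_distrib_left)
  finally show ?thesis
    by simp
qed

end

section \<open>One channel of a protocol\<close>

lemma channel_snoc:
  "channel i (t @ [(l, c)]) = (if l = i then channel i t @ [c] else channel i t)"
  by (simp add: channel_def)

lemma transcript_Suc: "transcript P Es (Suc m) = step P Es (transcript P Es m)"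
  by (simp add: transcript_def)

lemma length_transcript_le: "length (transcript P Es m) \<le> m"
  by (induction m) (auto simp: transcript_Suc step_def transcript_def[of P Es 0] split: option.split)

lemma transcript_players:
  "valid_protocol s P \<Longrightarrow> fst ` set (transcript P Es m) \<subseteq> {..<s}"
  by (induction m)
    (auto simp: transcript_Suc step_def transcript_def[of P Es 0] valid_protocol_def split: option.splits)

lemma sum_length_channel:
  "fst ` set t \<subseteq> {..<s} \<Longrightarrow> (\<Sum>i<s. length (channel i t)) = length t"
proof (induction t rule: rev_induct)
  case (snoc x t)
  obtain l c where x: "x = (l, c)"
    by force
  have "(\<Sum>i<s. length (channel i (t @ [x]))) = (\<Sum>i<s. length (channel i t) + (if i = l then 1 else 0))"
    by (intro sum.cong) (auto simp: x channel_snoc)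
  then show ?case
    using snoc x by (simp add: sum.distrib)
qed (simp add: channel_def)

text \<open>Only the bits sent by the player are constrained. The condition depends on its input and
  its own channel alone, and so describes one side of a rectangle.\<close>

definition consistent :: "protocol \<Rightarrow> nat \<Rightarrow> edges \<Rightarrow> bool list \<Rightarrow> bool" where
  "consistent P i E t \<longleftrightarrow>
     (\<forall>k<length t. coord_turn P i (take k t) \<or> t ! k = player_bit P i E (take k t))"

lemma consistent_snoc:
  "consistent P i E (t @ [c]) \<longleftrightarrow> consistent P i E t \<and> (coord_turn P i t \<or> c = player_bit P i E t)"
  by (auto simp: consistent_def nth_append less_Suc_eq)

lemma consistent_channel: "consistent P i (Es ! i) (channel i (transcript P Es m))"
proof (induction m)
  case 0
  then show ?case
    by (simp add: transcript_def channel_def consistent_def)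
next
  case (Suc m)
  then show ?case
    by (auto simp: transcript_Suc step_def channel_snoc consistent_snoc split: option.split)
qed

text \<open>Two such runs can first differ only at a bit sent by player \<open>i\<close>, and
  consistency fixes that bit.\<close>

lemma transcript_eq_if_consistent:
  assumes "\<And>l. l \<noteq> i \<Longrightarrow> Es ! l = Es' ! l" "consistent P i (Es' ! i) (channel i (transcript P Es m))"
  shows "transcript P Es' m = transcript P Es m"
  using assms(2)
proof (induction m)
  case 0
  then show ?case
    by (simp add: transcript_def)
next
  case (Suc m)
  then show ?case
    using assms(1)
    by (auto simp: transcript_Suc step_def channel_snoc consistent_snoc split: option.splits if_splits)
qed

definition input :: "nat \<Rightarrow> (nat \<Rightarrow> edges) \<Rightarrow> edges list" where
  "input s X = map X [0..<s]"

text \<open>The run on \<open>r'\<close> and \<open>x'\<close> shows that the channel content is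
  consistent with \<open>x'\<close>, which does not involve the other inputs.\<close>

lemma transcript_rectangle:
  assumes "i < s"
    and "channel i (transcript P (input s (r(i := x))) m) = channel i (transcript P (input s (r'(i := x'))) m)"
  shows "transcript P (input s (r(i := x'))) m = transcript P (input s (r(i := x))) m"
proof -
  have nth: "input s X ! l = X l" if "l < s" for X l
    using that by (simp add: input_def)
  have "input s (r(i := x')) = (input s (r(i := x)))[i := x']"
    by (rule nth_equalityI) (auto simp: input_def nth_list_update)
  then have "input s (r(i := x)) ! l = input s (r(i := x')) ! l" if "l \<noteq> i" for l
    using that by simp
  moreover have "consistent P i x' (channel i (transcript P (input s (r(i := x))) m))"
    using consistent_channel[of P i "input s (r'(i := x'))" m] assms nth by simp
  ultimately show ?thesis
    using transcript_eq_if_consistent[of i "input s (r(i := x))" "input s (r(i := x'))" P m] nth assms(1)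
    by simp
qed

section \<open>The hard distribution\<close>

text \<open>Given the hidden set \<open>D\<close>, a player holds each element of \<open>D\<close> with probability \<open>1/3\<close>. With
  \<open>3/4\<close> as the probability of an element to be in \<open>D\<close>, this arises for each player from fair bits:
  a fair auxiliary set \<open>A\<close>, a fair subset of \<open>A\<close> as input, and a fair subset of \<open>J - A\<close> added to \<open>A\<close>
  to form \<open>D\<close>.\<close>

definition subset_weight :: "'a set \<Rightarrow> 'a set \<Rightarrow> real" where
  "subset_weight D y = of_bool (y \<subseteq> D) * 2 ^ card (D - y) / 3 ^ card D"

definition players_weight :: "nat set \<Rightarrow> 'a set \<Rightarrow> (nat \<Rightarrow> 'a set) \<Rightarrow> real" where
  "players_weight I D X = (\<Prod>l\<in>I. subset_weight D (X l))"

lemma subset_weight_nonneg: "0 \<le> subset_weight D y"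
  by (simp add: subset_weight_def)

lemma players_weight_nonneg: "0 \<le> players_weight I D X"
  by (simp add: players_weight_def prod_nonneg subset_weight_nonneg)

lemma sum_subset_weight_mult:
  assumes "finite J" "D \<subseteq> J"
  shows "3 ^ card D * (\<Sum>y\<in>Pow J. subset_weight D y * f y) = (\<Sum>y\<in>Pow D. 2 ^ card (D - y) * f y)"
proof -
  have "3 ^ card D * (\<Sum>y\<in>Pow J. subset_weight D y * f y)
      = (\<Sum>y\<in>Pow J. if y \<in> Pow D then 2 ^ card (D - y) * f y else 0)"
    unfolding sum_distrib_left by (intro sum.cong refl) (auto simp: subset_weight_def)
  also have "\<dots> = (\<Sum>y\<in>Pow J \<inter> Pow D. 2 ^ card (D - y) * f y)"
    using assms by (simp add: sum.inter_restrict)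
  also have "Pow J \<inter> Pow D = Pow D"
    using assms by auto
  finally show ?thesis .
qed

lemma sum_Pow_card_Diff: "finite D \<Longrightarrow> (\<Sum>y\<in>Pow D. 2 ^ card (D - y)) = (3 :: real) ^ card D"
  using prod_add[of D "\<lambda>_. 1" "\<lambda>_. 2 :: real"] by simp

lemma sum_subset_weight:
  assumes "finite J" "D \<subseteq> J"
  shows "(\<Sum>y\<in>Pow J. subset_weight D y) = 1"
  using sum_subset_weight_mult[OF assms, of "\<lambda>_. 1"] sum_Pow_card_Diff[of D] assms finite_subset[of D J]
  by simp

lemma sum_players_weight:
  assumes "finite J" "D \<subseteq> J" "finite I"
  shows "(\<Sum>X\<in>PiE I (\<lambda>_. Pow J). players_weight I D X) = 1"
  using assms prod_sum_PiE[of I "\<lambda>_. Pow J" "\<lambda>_. subset_weight D"]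
  by (simp add: players_weight_def sum_subset_weight)

lemma sum_players_weight_insert:
  assumes "finite J" "finite I" "i \<notin> I"
  shows "(\<Sum>X\<in>PiE (insert i I) (\<lambda>_. Pow J). players_weight (insert i I) D X * \<phi> X)
       = (\<Sum>x\<in>Pow J. subset_weight D x * (\<Sum>r\<in>PiE I (\<lambda>_. Pow J). players_weight I D r * \<phi> (r(i := x))))"
proof -
  have "players_weight (insert i I) D (r(i := x)) = subset_weight D x * players_weight I D r" for r x
  proof -
    have "(\<Prod>l\<in>I. subset_weight D ((r(i := x)) l)) = (\<Prod>l\<in>I. subset_weight D (r l))"
      using assms by (intro prod.cong) auto
    then show ?thesis
      using assms by (simp add: players_weight_def)
  qed
  moreover have "(\<Sum>X\<in>PiE (insert i I) (\<lambda>_. Pow J). players_weight (insert i I) D X * \<phi> X)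
      = (\<Sum>(x, r)\<in>Pow J \<times> PiE I (\<lambda>_. Pow J). players_weight (insert i I) D (r(i := x)) * \<phi> (r(i := x)))"
    unfolding PiE_insert_eq
    by (subst sum.reindex[OF inj_combinator[OF assms(3)]]) (simp add: case_prod_unfold)
  ultimately show ?thesis
    by (simp add: sum.cartesian_product[symmetric] sum_distrib_left mult.assoc)
qed

text \<open>The middle set of \<open>x \<subseteq> A \<subseteq> D\<close> is summed out, with
  \<open>F = D - A\<close>. An element of \<open>D\<close> lies in \<open>x\<close>, in
  \<open>A - x\<close> or in \<open>D - A\<close> with equal weight, which is the origin of the
  \<open>1/3\<close>.\<close>

lemma sum_sandwich:
  fixes h :: "'a set \<Rightarrow> 'a set \<Rightarrow> real"
  assumes "finite J"
  shows "(\<Sum>A\<in>Pow J. \<Sum>x\<in>Pow A. \<Sum>F\<in>Pow (J - A). h x (A \<union> F))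
       = (\<Sum>D\<in>Pow J. \<Sum>x\<in>Pow D. 2 ^ card (D - x) * h x D)"
proof -
  have fin: "finite A" if "A \<in> Pow J" for A
    using that assms finite_subset by auto
  have fin': "finite (Pow (J - A))" for A
    using assms by simp
  have "(\<Sum>A\<in>Pow J. \<Sum>x\<in>Pow A. \<Sum>F\<in>Pow (J - A). h x (A \<union> F))
      = (\<Sum>A\<in>Pow J. \<Sum>(x, F)\<in>Pow A \<times> Pow (J - A). h x (A \<union> F))"
    by (simp add: sum.cartesian_product)
  also have "\<dots> = (\<Sum>(A, x, F)\<in>(SIGMA A:Pow J. Pow A \<times> Pow (J - A)). h x (A \<union> F))"
    using assms fin fin' by (subst sum.Sigma) auto
  also have "\<dots> = (\<Sum>(D, x, G)\<in>(SIGMA D:Pow J. SIGMA x:Pow D. Pow (D - x)). h x D)"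
    by (rule sum.reindex_bij_witness[where i = "\<lambda>(D, x, G). (D - G, x, G)" and j = "\<lambda>(A, x, F). (A \<union> F, x, F)"])
      auto
  also have "\<dots> = (\<Sum>D\<in>Pow J. \<Sum>(x, G)\<in>(SIGMA x:Pow D. Pow (D - x)). h x D)"
    using assms fin by (subst sum.Sigma) (auto intro!: finite_SigmaI)
  also have "\<dots> = (\<Sum>D\<in>Pow J. \<Sum>x\<in>Pow D. \<Sum>G\<in>Pow (D - x). h x D)"
    using fin by (intro sum.cong[OF refl], subst sum.Sigma) auto
  also have "\<dots> = (\<Sum>D\<in>Pow J. \<Sum>x\<in>Pow D. 2 ^ card (D - x) * h x D)"
    using fin by (intro sum.cong refl) (auto simp: card_Pow)
  finally show ?thesis .
qed

text \<open>The joint law of all inputs, seen through the auxiliary set \<open>A\<close> of player \<open>i\<close>, does not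
  depend on \<open>i\<close>.\<close>

lemma sum_auxiliary_eq:
  assumes J: "finite J" and i: "i < s"
  shows "(\<Sum>A\<in>Pow J. \<Sum>x\<in>Pow A. \<Sum>F\<in>Pow (J - A). \<Sum>r\<in>PiE ({..<s} - {i}) (\<lambda>_. Pow J).
            players_weight ({..<s} - {i}) (A \<union> F) r * \<phi> (r(i := x)))
       = (\<Sum>D\<in>Pow J. 3 ^ card D *
            (\<Sum>X\<in>PiE {..<s} (\<lambda>_. Pow J). players_weight {..<s} D X * \<phi> X))"
proof -
  have ins: "insert i ({..<s} - {i}) = {..<s}"
    using i by auto
  have "3 ^ card D * (\<Sum>X\<in>PiE {..<s} (\<lambda>_. Pow J). players_weight {..<s} D X * \<phi> X)
      = (\<Sum>x\<in>Pow D. 2 ^ card (D - x) * (\<Sum>r\<in>PiE ({..<s} - {i}) (\<lambda>_. Pow J).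
            players_weight ({..<s} - {i}) D r * \<phi> (r(i := x))))" if "D \<in> Pow J" for D
    using sum_players_weight_insert[OF J, of "{..<s} - {i}" i D \<phi>] sum_subset_weight_mult[OF J, of D] that
    unfolding ins by simp
  then show ?thesis
    by (subst sum_sandwich[OF J]) simp
qed

section \<open>Lower bound for unions\<close>

text \<open>Integrability is carried along so that the bounds pass through finite sums.\<close>

definition expectation_ge :: "'p pmf \<Rightarrow> ('p \<Rightarrow> real) \<Rightarrow> real \<Rightarrow> bool" where
  "expectation_ge R f v \<longleftrightarrow> integrable (measure_pmf R) f \<and> v \<le> measure_pmf.expectation R f"

lemma expectation_ge_sum:
  "(\<And>z. z \<in> I \<Longrightarrow> expectation_ge R (f z) (v z)) \<Longrightarrow> expectation_ge R (\<lambda>P. \<Sum>z\<in>I. f z P) (\<Sum>z\<in>I. v z)"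
  by (auto simp: expectation_ge_def intro!: sum_mono)

lemma expectation_ge_le:
  assumes "expectation_ge R f v" "\<And>P. P \<in> set_pmf R \<Longrightarrow> f P \<le> B"
  shows "v \<le> B"
proof -
  have "measure_pmf.expectation R f \<le> measure_pmf.expectation R (\<lambda>_. B)"
    using assms by (intro integral_mono_AE) (auto simp: expectation_ge_def AE_measure_pmf_iff)
  then show ?thesis
    using assms(1) by (simp add: expectation_ge_def)
qed

text \<open>The first success event forces \<open>c0\<close> and the second excludes
  \<open>c1\<close>, so their probabilities are at least \<open>2/3\<close> and at most
  \<open>1/3\<close>.\<close>

lemma expectation_ge_advantage:
  assumes "measure_pmf.prob R {P. Q0 P} \<ge> 2 / 3" "measure_pmf.prob R {P. Q1 P} \<ge> 2 / 3"
    and "\<And>P. Q0 P \<Longrightarrow> c0 P" "\<And>P. Q1 P \<Longrightarrow> \<not> c1 P" and "w \<ge> 0"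
  shows "expectation_ge R (\<lambda>P. w * (of_bool (c0 P) - of_bool (c1 P))) (w * (1 / 3))"
proof -
  have int: "integrable (measure_pmf R) (\<lambda>P. of_bool (Q P) :: real)" for Q
    by (intro measure_pmf.integrable_const_bound[where B = 1]) auto
  have ex: "measure_pmf.expectation R (\<lambda>P. of_bool (Q P) :: real) = measure_pmf.prob R {P. Q P}" for Q
  proof -
    have "(\<lambda>P. of_bool (Q P) :: real) = indicat_real {P. Q P}"
      by (auto simp: indicator_def)
    then show ?thesis
      by simp
  qed
  have "measure_pmf.prob R {P. Q0 P} \<le> measure_pmf.prob R {P. c0 P}"
    using assms by (intro measure_pmf.finite_measure_mono) auto
  moreover have "measure_pmf.prob R {P. Q1 P} \<le> 1 - measure_pmf.prob R {P. c1 P}"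
  proof -
    have "measure_pmf.prob R {P. Q1 P} \<le> measure_pmf.prob R (- {P. c1 P})"
      using assms by (intro measure_pmf.finite_measure_mono) auto
    then show ?thesis
      using measure_pmf.prob_compl[of "{P. c1 P}" R] by (simp add: Compl_eq_Diff_UNIV)
  qed
  ultimately have "1 / 3 \<le> measure_pmf.expectation R (\<lambda>P. of_bool (c0 P) - of_bool (c1 P) :: real)"
    using assms(1,2) by (subst Bochner_Integration.integral_diff[OF int int]) (simp add: ex)
  then have "w * (1 / 3) \<le> w * measure_pmf.expectation R (\<lambda>P. of_bool (c0 P) - of_bool (c1 P) :: real)"
    using \<open>w \<ge> 0\<close> by (rule mult_left_mono)
  moreover have "integrable (measure_pmf R) (\<lambda>P. of_bool (c0 P) - of_bool (c1 P) :: real)"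
    by (intro Bochner_Integration.integrable_diff int)
  ultimately show ?thesis
    unfolding expectation_ge_def by (simp only: integral_mult_right_zero integrable_mult_right simp_thms)
qed

text \<open>The total advantage over all channels is averaged over \<open>R\<close>: correctness
  makes it large on average, while for each protocol it is small unless the channels carry many
  bits.\<close>

lemma union_communication_ge:
  assumes J: "finite J"
    and valid: "\<And>P. P \<in> set_pmf R \<Longrightarrow> valid_protocol s P"
    and correct: "\<And>X. X \<in> PiE {..<s} (\<lambda>_. Pow J) \<Longrightarrow>
       measure_pmf.prob R {P. result P (transcript P (input s X) m) = (\<Union>l<s. X l)} \<ge> 2 / 3"
  shows "real s * real (card J) \<le> 1152 * (2 * real m + real s)"
proof -
  define I where "I i = {..<s} - {i}" for i
  define Rs where "Rs i = PiE (I i) (\<lambda>_. Pow J)" for i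
  define \<tau> where "\<tau> P i x r = channel i (transcript P (input s (r(i := x))) m)" for P i x r
  define out where "out P i x r = result P (transcript P (input s (r(i := x))) m)" for P i x r
  define N where "N = card J"
  define adv where "adv P i = (\<Sum>j\<in>J. \<Sum>C\<in>Pow (J - {j}). \<Sum>x\<in>Pow C. \<Sum>F\<in>Pow (J - {j} - C). \<Sum>r\<in>Rs i.
      players_weight (I i) (C \<union> F) r *
        (of_bool (j \<notin> out P i x r) - of_bool (j \<notin> out P i (insert j x) r)))" for P i
  have fin: "finite (I i)" "finite (Rs i)" for i
    using J by (auto simp: I_def Rs_def intro!: finite_PiE)
  have sub: "r(i := x) \<in> PiE {..<s} (\<lambda>_. Pow J)" if "r \<in> Rs i" "x \<subseteq> J" "i < s" for r i x
    using that by (auto simp: Rs_def I_def PiE_def extensional_def Pi_def)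

  have adv_le: "adv P i \<le> real N * 4 ^ N / 24
      + 48 * (\<Sum>D\<in>Pow J. 3 ^ card D * (\<Sum>X\<in>PiE {..<s} (\<lambda>_. Pow J).
          players_weight {..<s} D X * (2 * real (length (channel i (transcript P (input s X) m))) + 1)))"
    if i: "i < s" for P i
  proof -
    \<comment> \<open>Alice is player \<open>i\<close>. Bob simulates the coordinator and all other
      players, and \<open>r\<close> is the family of their inputs.\<close>
    interpret rectangle_channel J "Rs i" "players_weight (I i)" "\<tau> P i" "out P i"
    proof
      show "finite J" "finite (Rs i)"
        by fact+
      show "0 \<le> players_weight (I i) D r" for D r
        by (rule players_weight_nonneg)
      show "(\<Sum>r\<in>Rs i. players_weight (I i) D r) = 1" if "D \<subseteq> J" for D
        unfolding Rs_def by (rule sum_players_weight[OF J that fin(1)])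
      show "\<tau> P i x' r = \<tau> P i x r \<and> out P i x' r = out P i x r" if "\<tau> P i x r = \<tau> P i x' r'" for x x' r r'
        using transcript_rectangle[OF i, of P r x m r' x'] that by (simp add: \<tau>_def out_def)
    qed
    show ?thesis
      using total_advantage_le
        sum_auxiliary_eq[OF J i, of "\<lambda>X. 2 * real (length (channel i (transcript P (input s X) m))) + 1"]
      unfolding adv_def N_def \<tau>_def Rs_def I_def by simp
  qed

  have length_sum: "(\<Sum>i<s. \<Sum>D\<in>Pow J. 3 ^ card D * (\<Sum>X\<in>PiE {..<s} (\<lambda>_. Pow J).
      players_weight {..<s} D X * (2 * real (length (channel i (transcript P (input s X) m))) + 1)))
    \<le> 4 ^ N * (2 * real m + real s)" if P: "P \<in> set_pmf R" for P
  proof -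
    let ?len = "\<lambda>i X. 2 * real (length (channel i (transcript P (input s X) m))) + 1"
    \<comment> \<open>Each exchanged bit lies on exactly one channel; the additive 1 is paid once
      per channel.\<close>
    have len: "(\<Sum>i<s. ?len i X) \<le> 2 * real m + real s" for X
    proof -
      have "(\<Sum>i<s. ?len i X) = 2 * real (\<Sum>i<s. length (channel i (transcript P (input s X) m))) + real s"
        by (simp add: sum.distrib sum_distrib_left)
      then show ?thesis
        using sum_length_channel[OF transcript_players[OF valid[OF P]]] length_transcript_le by simp
    qed
    have "(\<Sum>i<s. \<Sum>D\<in>Pow J. 3 ^ card D * (\<Sum>X\<in>PiE {..<s} (\<lambda>_. Pow J). players_weight {..<s} D X * ?len i X))
        = (\<Sum>D\<in>Pow J. 3 ^ card D * (\<Sum>i<s. \<Sum>X\<in>PiE {..<s} (\<lambda>_. Pow J). players_weight {..<s} D X * ?len i X))"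
      by (subst sum.swap) (simp only: sum_distrib_left)
    also have "\<dots> = (\<Sum>D\<in>Pow J. 3 ^ card D * (\<Sum>X\<in>PiE {..<s} (\<lambda>_. Pow J). players_weight {..<s} D X * (\<Sum>i<s. ?len i X)))"
      by (subst sum.swap) (simp only: sum_distrib_left)
    also have "\<dots> \<le> (\<Sum>D\<in>Pow J. 3 ^ card D * (\<Sum>X\<in>PiE {..<s} (\<lambda>_. Pow J). players_weight {..<s} D X * (2 * real m + real s)))"
      by (intro sum_mono mult_left_mono len players_weight_nonneg) auto
    also have "\<dots> = (\<Sum>D\<in>Pow J. 3 ^ card D * (2 * real m + real s))"
      using J by (intro sum.cong refl) (auto simp: sum_players_weight simp flip: sum_distrib_right)
    \<comment> \<open>The weights \<open>3 ^ card D\<close> sum to \<open>4 ^ N\<close>: an element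
      is in \<open>D\<close> with probability \<open>3/4\<close>.\<close>
    also have "\<dots> = 4 ^ N * (2 * real m + real s)"
      using prod_add[OF J, of "\<lambda>_. 3 :: real" "\<lambda>_. 1"]
      by (simp add: N_def flip: sum_distrib_right)
    finally show ?thesis .
  qed

  have "expectation_ge R (\<lambda>P. \<Sum>i<s. adv P i) (\<Sum>i<s. \<Sum>j\<in>J. \<Sum>C\<in>Pow (J - {j}). \<Sum>x\<in>Pow C.
      \<Sum>F\<in>Pow (J - {j} - C). \<Sum>r\<in>Rs i. players_weight (I i) (C \<union> F) r * (1 / 3))"
    unfolding adv_def
  proof (intro expectation_ge_sum)
    fix i j C x F r
    assume h: "i \<in> {..<s}" "j \<in> J" "C \<in> Pow (J - {j})" "x \<in> Pow C" "F \<in> Pow (J - {j} - C)" "r \<in> Rs i"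
    let ?w = "players_weight (I i) (C \<union> F) r"
    show "expectation_ge R (\<lambda>P. ?w * (of_bool (j \<notin> out P i x r) - of_bool (j \<notin> out P i (insert j x) r))) (?w * (1 / 3))"
    proof (cases "?w = 0")
      case True
      then show ?thesis
        by (simp add: expectation_ge_def)
    next
      case False
      \<comment> \<open>At nonzero weight no other player holds \<open>j\<close>, so player
        \<open>i\<close> alone decides whether \<open>j\<close> is in the union.\<close>
      then have rl: "r l \<subseteq> C \<union> F" if "l \<in> I i" for l
        using that fin by (auto simp: players_weight_def subset_weight_def)
      have "j \<notin> (\<Union>l<s. (r(i := x)) l)"
        using rl h by (fastforce simp: I_def split: if_splits)
      moreover have "j \<in> (\<Union>l<s. (r(i := insert j x)) l)"
        using h by auto
      moreover have "r(i := x) \<in> PiE {..<s} (\<lambda>_. Pow J)" "r(i := insert j x) \<in> PiE {..<s} (\<lambda>_. Pow J)"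
        using h by (intro sub; blast)+
      ultimately show ?thesis
        using expectation_ge_advantage[OF correct[of "r(i := x)"] correct[of "r(i := insert j x)"],
            where ?c0.0 = "\<lambda>P. j \<notin> out P i x r" and ?c1.0 = "\<lambda>P. j \<notin> out P i (insert j x) r" and w = ?w]
          players_weight_nonneg[of "I i" "C \<union> F" r]
        unfolding out_def by simp
    qed
  qed
  \<comment> \<open>There are \<open>2 ^ (N - 1)\<close> sets \<open>C\<close>, each with
    \<open>2 ^ (N - 1)\<close> pairs of \<open>x\<close> and \<open>F\<close>, and each pair
    contributes \<open>1/3\<close>.\<close>
  moreover have "(\<Sum>i<s. \<Sum>j\<in>J. \<Sum>C\<in>Pow (J - {j}). \<Sum>x\<in>Pow C. \<Sum>F\<in>Pow (J - {j} - C). \<Sum>r\<in>Rs i.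
      players_weight (I i) (C \<union> F) r * (1 / 3)) = (\<Sum>i<s. \<Sum>j\<in>J. 4 ^ N / 12 :: real)"
  proof (rule sum.cong[OF refl], rule sum.cong[OF refl])
    fix i j assume j: "j \<in> J"
    have "(\<Sum>r\<in>Rs i. players_weight (I i) (C \<union> F) r * (1 / 3)) = 1 / 3"
      if "C \<in> Pow (J - {j})" "F \<in> Pow (J - {j} - C)" for C F
    proof -
      have "C \<union> F \<subseteq> J"
        using that by auto
      then show ?thesis
        using sum_players_weight[OF J _ fin(1)] by (simp add: Rs_def flip: sum_distrib_right sum_divide_distrib)
    qed
    then have "(\<Sum>C\<in>Pow (J - {j}). \<Sum>x\<in>Pow C. \<Sum>F\<in>Pow (J - {j} - C). \<Sum>r\<in>Rs i.
        players_weight (I i) (C \<union> F) r * (1 / 3))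
      = (\<Sum>C\<in>Pow (J - {j}). \<Sum>x\<in>Pow C. \<Sum>F\<in>Pow (J - {j} - C). 1 / 3)"
      by (intro sum.cong refl) auto
    also have "\<dots> = (\<Sum>C\<in>Pow (J - {j}). 2 ^ card (J - {j}) / 3)"
    proof (rule sum.cong[OF refl])
      fix C assume "C \<in> Pow (J - {j})"
      then have C: "C \<subseteq> J - {j}" "finite C" "finite (J - {j})"
        using J finite_subset by auto
      then have "card (J - {j}) = card C + card (J - {j} - C)"
        by (simp add: card_Diff_subset card_mono)
      then show "(\<Sum>x\<in>Pow C. \<Sum>F\<in>Pow (J - {j} - C). 1 / 3) = (2 ^ card (J - {j}) / 3 :: real)"
        using C by (simp add: card_Pow power_add)
    qed
    also have "\<dots> = 2 ^ card (J - {j}) * 2 ^ card (J - {j}) / 3"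
      using J by (simp add: card_Pow)
    also have "\<dots> = 4 ^ card (J - {j}) / 3"
      by (simp flip: power_mult_distrib)
    also have "\<dots> = 4 ^ N / 12"
    proof -
      have "N = Suc (card (J - {j}))"
        unfolding N_def using j J by (metis card_Suc_Diff1)
      then show ?thesis
        by simp
    qed
    finally show "(\<Sum>C\<in>Pow (J - {j}). \<Sum>x\<in>Pow C. \<Sum>F\<in>Pow (J - {j} - C). \<Sum>r\<in>Rs i.
        players_weight (I i) (C \<union> F) r * (1 / 3)) = (4 ^ N / 12 :: real)" .
  qed
  ultimately have "expectation_ge R (\<lambda>P. \<Sum>i<s. adv P i) (\<Sum>i<s. \<Sum>j\<in>J. 4 ^ N / 12)"
    by (simp only:)
  then have eg: "expectation_ge R (\<lambda>P. \<Sum>i<s. adv P i) (real s * real N * 4 ^ N / 12)"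
    by (simp add: N_def mult.assoc)
  have "(\<Sum>i<s. adv P i) \<le> real s * real N * 4 ^ N / 24 + 48 * (4 ^ N * (2 * real m + real s))"
    if P: "P \<in> set_pmf R" for P
  proof -
    have "(\<Sum>i<s. adv P i) \<le> (\<Sum>i<s. real N * 4 ^ N / 24
      + 48 * (\<Sum>D\<in>Pow J. 3 ^ card D * (\<Sum>X\<in>PiE {..<s} (\<lambda>_. Pow J).
          players_weight {..<s} D X * (2 * real (length (channel i (transcript P (input s X) m))) + 1))))"
      by (intro sum_mono adv_le) auto
    also have "\<dots> = real s * real N * 4 ^ N / 24 + 48 * (\<Sum>i<s. \<Sum>D\<in>Pow J. 3 ^ card D * (\<Sum>X\<in>PiE {..<s} (\<lambda>_. Pow J).
          players_weight {..<s} D X * (2 * real (length (channel i (transcript P (input s X) m))) + 1)))"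
      by (simp only: sum.distrib sum_distrib_left[symmetric]) simp
    finally show ?thesis
      using length_sum[OF P] by linarith
  qed
  then have "real s * real N * 4 ^ N / 12 \<le> real s * real N * 4 ^ N / 24 + 48 * (4 ^ N * (2 * real m + real s))"
    by (rule expectation_ge_le[OF eg])
  \<comment> \<open>The difference of \<open>1/12\<close> and \<open>1/24\<close> is
    \<open>1/24\<close>, and \<open>24 * 48 = 1152\<close>.\<close>
  then have "4 ^ N * (real s * real N) \<le> 4 ^ N * (1152 * (2 * real m + real s))"
    by (simp add: algebra_simps)
  then show ?thesis
    by (simp add: N_def)
qed

section \<open>Spanners of bipartite graphs\<close>

definition bipartite_edges :: "nat \<Rightarrow> edges" where
  "bipartite_edges n = {{u, v} |u v. u < n div 2 \<and> n div 2 \<le> v \<and> v < n}"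

lemma bipartite_edges_eq_image:
  "bipartite_edges n = (\<lambda>(u, v). {u, v}) ` ({..<n div 2} \<times> {n div 2..<n})"
  unfolding bipartite_edges_def by (auto simp: image_iff) (metis)+

lemma finite_bipartite_edges: "finite (bipartite_edges n)"
  by (simp add: bipartite_edges_eq_image)

lemma card_bipartite_edges: "card (bipartite_edges n) = (n div 2) * (n - n div 2)"
proof -
  have "inj_on (\<lambda>(u, v). {u, v}) ({..<n div 2} \<times> {n div 2..<n})"
    by (auto simp: inj_on_def doubleton_eq_iff)
  then show ?thesis
    by (simp add: bipartite_edges_eq_image card_image)
qed

lemma card_bipartite_edges_ge:
  assumes "2 \<le> n"
  shows "real n ^ 2 / 8 \<le> real (card (bipartite_edges n))"
proof -
  have "n\<^sup>2 \<le> 8 * ((n div 2) * (n - n div 2))"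
  proof (cases "even n")
    case True
    then obtain k where "n = 2 * k"
      by (elim evenE)
    then show ?thesis
      by (simp add: power2_eq_square)
  next
    case False
    then obtain k where k: "n = 2 * k + 1"
      by (elim oddE)
    then have "k \<ge> 1" "k * k \<ge> k"
      using assms by auto
    then show ?thesis
      using k by (simp add: power2_eq_square algebra_simps)
  qed
  then have "real (n\<^sup>2) \<le> real (8 * ((n div 2) * (n - n div 2)))"
    by (simp only: of_nat_le_iff)
  then show ?thesis
    by (simp add: card_bipartite_edges)
qed

lemma bipartite_edges_subset: "bipartite_edges n \<subseteq> all_edges n"
  unfolding bipartite_edges_def all_edges_def by fastforce

lemma bipartite_edges_side:
  "{x, y} \<in> bipartite_edges n \<Longrightarrow> x < n div 2 \<longleftrightarrow> \<not> y < n div 2"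
  by (auto simp: bipartite_edges_def doubleton_eq_iff)

lemma gdist_le_one: "{u, v} \<in> G \<Longrightarrow> gdist G u v \<le> 1"
proof -
  assume "{u, v} \<in> G"
  then have "[u, v] \<in> walks G u v"
    by (simp add: walks_def)
  then have "gdist G u v \<le> enat (length [u, v] - 1)"
    unfolding gdist_def by (rule INF_lower)
  then show ?thesis
    by (simp add: one_enat_def)
qed

lemma gdist_le_two_obtains_walk:
  assumes "gdist H u v \<le> 2"
  obtains p where "p \<in> walks H u v" "length p \<le> 3"
proof -
  have ne: "walks H u v \<noteq> {}"
    using assms by (auto simp: gdist_def Inf_enat_def numeral_eq_enat split: if_splits)
  then have "gdist H u v \<in> (\<lambda>p. enat (length p - 1)) ` walks H u v"
    unfolding gdist_def Inf_enat_def by (auto intro: LeastI)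
  then obtain p where p: "p \<in> walks H u v" "gdist H u v = enat (length p - 1)"
    by auto
  then have "length p \<le> 3"
    using assms by (simp add: numeral_eq_enat)
  then show thesis
    using p that by blast
qed

text \<open>A detour for an edge of a bipartite graph has length at least \<open>3\<close>.\<close>

lemma two_spanner_bipartite_eq:
  assumes G: "G \<subseteq> bipartite_edges n" and H: "is_spanner 2 n G H"
  shows "H = G"
proof
  show HG: "H \<subseteq> G"
    using H by (simp add: is_spanner_def)
  show "G \<subseteq> H"
  proof
    fix e assume e: "e \<in> G"
    then obtain u v where uv: "e = {u, v}" "u < n div 2" "n div 2 \<le> v" "v < n"
      using G by (auto simp: bipartite_edges_def)
    have "ereal_of_enat (gdist H u v) \<le> ereal 2 * ereal_of_enat (gdist G u v)"
      using H uv by (simp add: is_spanner_def)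
    also have "\<dots> \<le> ereal 2 * ereal_of_enat 1"
      using gdist_le_one[of u v G] e uv by (intro ereal_mult_left_mono) auto
    also have "\<dots> = ereal_of_enat 2"
      by (simp add: one_enat_def numeral_eq_enat)
    finally have "gdist H u v \<le> 2"
      by (simp only: ereal_of_enat_le_iff)
    then obtain p where p: "p \<in> walks H u v" "length p \<le> 3"
      by (rule gdist_le_two_obtains_walk)
    have side: "x < n div 2 \<longleftrightarrow> \<not> y < n div 2" if "{x, y} \<in> H" for x y
      using that HG G bipartite_edges_side by blast
    have "u \<noteq> v"
      using uv by simp
    \<comment> \<open>Walks are lists of vertices, so length 3 means two edges.\<close>
    consider x where "p = [x]" | x y where "p = [x, y]" | x y z where "p = [x, y, z]"
      using p by (cases p rule: remdups_adj.cases; cases "tl (tl p)") (auto simp: walks_def Suc_le_eq)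
    then show "e \<in> H"
    proof cases
      case 1
      then show ?thesis
        using p \<open>u \<noteq> v\<close> by (simp add: walks_def)
    next
      case 2
      then show ?thesis
        using p uv by (auto simp: walks_def)
    next
      case 3
      then have "{u, y} \<in> H" "{y, v} \<in> H"
        using p by (auto simp: walks_def)
      then show ?thesis
        using side[of u y] side[of y v] uv by auto
    qed
  qed
qed

lemma is_spanner_refl: "is_spanner 2 n G G"
proof -
  have "ereal_of_enat d \<le> ereal 2 * ereal_of_enat d" for d
    by (cases d) auto
  then show ?thesis
    by (simp add: is_spanner_def)
qed

section \<open>Communication cost of 2-spanners\<close>

lemma computes_spanner_ge:
  assumes n: "136 \<le> n" and R: "computes_spanner 2 s n m R"
  shows "real s * real n ^ 2 / 36864 \<le> real m"
proof -
  let ?J = "bipartite_edges n"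
  have "real s * real (card ?J) \<le> 1152 * (2 * real m + real s)"
  proof (rule union_communication_ge[OF finite_bipartite_edges])
    show "valid_protocol s P" if "P \<in> set_pmf R" for P
      using R that by (simp add: computes_spanner_def)
    fix X assume X: "X \<in> PiE {..<s} (\<lambda>_. Pow ?J)"
    then have XJ: "X l \<subseteq> ?J" if "l < s" for l
      using that by auto
    have U: "\<Union> (set (input s X)) = (\<Union>l<s. X l)"
      by (auto simp: input_def)
    have "input s X \<in> inputs s n"
      using XJ subset_trans[OF _ bipartite_edges_subset] by (simp add: inputs_def input_def)
    then have "2 / 3 \<le> measure_pmf.prob R
        {P. is_spanner 2 n (\<Union> (set (input s X))) (result P (transcript P (input s X) m))}"
      using R by (simp add: computes_spanner_def)
    also have "\<dots> \<le> measure_pmf.prob R {P. result P (transcript P (input s X) m) = (\<Union>l<s. X l)}"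
    proof (intro measure_pmf.finite_measure_mono)
      have "(\<Union>l<s. X l) \<subseteq> ?J"
        using XJ by blast
      then show "{P. is_spanner 2 n (\<Union> (set (input s X))) (result P (transcript P (input s X) m))}
          \<subseteq> {P. result P (transcript P (input s X) m) = (\<Union>l<s. X l)}"
        unfolding U using two_spanner_bipartite_eq by blast
    qed simp
    finally show "2 / 3 \<le> measure_pmf.prob R {P. result P (transcript P (input s X) m) = (\<Union>l<s. X l)}" .
  qed
  moreover have "real s * (real n ^ 2 / 8) \<le> real s * real (card ?J)"
    using n by (intro mult_left_mono card_bipartite_edges_ge) auto
  \<comment> \<open>Since \<open>136\<^sup>2 = 18496\<close> exceeds \<open>16 * 1152\<close>, the
    term \<open>1152 * s\<close> uses up at most half of \<open>s * n\<^sup>2 / 8\<close>. The other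
    half gives \<open>36864 = 16 * 2304\<close>.\<close>
  moreover have "real s * 18496 \<le> real s * real n ^ 2"
    using n power_mono[of 136 "real n" 2] by (intro mult_left_mono) auto
  ultimately show ?thesis
    by simp
qed

text \<open>One after the other, the players send their adjacency matrices row by row; the length of
  the channel tells a player which entry is due. Diagonal entries are false on legal inputs.\<close>

definition send_all :: "nat \<Rightarrow> nat \<Rightarrow> protocol" where
  "send_all s n =
     \<lparr>next_player = \<lambda>t. if length t < s * (n * n) then Some (length t div (n * n)) else None,
      coord_turn = \<lambda>_ _. False,
      coord_bit = \<lambda>_. False,
      player_bit = \<lambda>i E c. {length c div n, length c mod n} \<in> E,
      result = \<lambda>t. {{u, v} |u v. u < n \<and> v < n \<and> (\<exists>i<s. t ! (i * (n * n) + (u * n + v)) = (i, True))}\<rparr>"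

lemma transcript_send_all:
  fixes n :: nat
  defines "M \<equiv> n * n"
  assumes "k \<le> s * M"
  shows "transcript (send_all s n) Es k =
    map (\<lambda>q. (q div M, {q mod M div n, q mod M mod n} \<in> Es ! (q div M))) [0..<k]"
  using assms(2)
proof (induction k)
  case 0
  then show ?case
    by (simp add: transcript_def)
next
  case (Suc k)
  let ?e = "\<lambda>q. (q div M, {q mod M div n, q mod M mod n} \<in> Es ! (q div M))"
  have k: "k < s * M"
    using Suc.prems by simp
  then have M: "M > 0"
    by (cases M) auto
  \<comment> \<open>The current player has sent the part of its block before \<open>k\<close>, so
    its channel has length \<open>k mod M\<close>, the index of the next entry.\<close>
  have "{q. q < k \<and> q div M = k div M} = {k div M * M..<k}"
  proof (intro set_eqI iffI)
    fix q assume "q \<in> {q. q < k \<and> q div M = k div M}"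
    then show "q \<in> {k div M * M..<k}"
      using div_times_less_eq_dividend[of q M] by auto
  next
    fix q assume q: "q \<in> {k div M * M..<k}"
    then have "k div M \<le> q div M"
      using M by (simp add: less_eq_div_iff_mult_less_eq)
    moreover have "q div M \<le> k div M"
      using q by (simp add: div_le_mono)
    ultimately show "q \<in> {q. q < k \<and> q div M = k div M}"
      using q by auto
  qed
  then have "length (channel (k div M) (map ?e [0..<k])) = k mod M"
    by (simp add: channel_def filter_map o_def length_filter_conv_card minus_div_mult_eq_mod cong: conj_cong)
  then show ?case
    using Suc k by (simp add: transcript_Suc step_def send_all_def M_def)
qed

lemma computes_spanner_send_all: "computes_spanner 2 s n (s * (n * n)) (return_pmf (send_all s n))"
proof -
  define M where "M = n * n"
  let ?P = "send_all s n"
  have valid: "valid_protocol s ?P"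
    by (auto simp: valid_protocol_def send_all_def less_mult_imp_div_less split: if_splits)
  have stops: "stops_within ?P Es (s * (n * n))" for Es
    by (subst stops_within_def, subst transcript_send_all) (auto simp: send_all_def)
  have result: "result ?P (transcript ?P Es (s * (n * n))) = \<Union> (set Es)" if Es: "Es \<in> inputs s n" for Es
  proof -
    let ?t = "transcript ?P Es (s * (n * n))"
    have nth: "?t ! (i * M + (u * n + v)) = (i, {u, v} \<in> Es ! i)" if "i < s" "u < n" "v < n" for i u v
    proof -
      have "u * n + v < M"
      proof -
        have "u * n + v < (u + 1) * n"
          using that by simp
        also have "\<dots> \<le> n * n"
          using that by (intro mult_le_mono1) simp
        finally show ?thesis
          by (simp add: M_def)
      qed
      moreover from this have "i * M + (u * n + v) < s * M"
      proof -
        have "i * M + (u * n + v) < (i + 1) * M"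
          using \<open>u * n + v < M\<close> by simp
        also have "\<dots> \<le> s * M"
          using that by (intro mult_le_mono1) simp
        finally show ?thesis .
      qed
      ultimately show ?thesis
        using that by (subst transcript_send_all) (simp_all add: M_def[symmetric])
    qed
    have "result ?P ?t = {{u, v} |u v. u < n \<and> v < n \<and> (\<exists>i<s. ?t ! (i * M + (u * n + v)) = (i, True))}"
      by (simp add: send_all_def M_def)
    also have "\<dots> = {{u, v} |u v. u < n \<and> v < n \<and> (\<exists>i<s. {u, v} \<in> Es ! i)}"
      using nth by (intro Collect_cong ex_cong1 conj_cong refl) auto
    also have "\<dots> = \<Union> (set Es)"
    proof
      show "{{u, v} |u v. u < n \<and> v < n \<and> (\<exists>i<s. {u, v} \<in> Es ! i)} \<subseteq> \<Union> (set Es)"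
        using Es nth_mem by (fastforce simp: inputs_def)
      show "\<Union> (set Es) \<subseteq> {{u, v} |u v. u < n \<and> v < n \<and> (\<exists>i<s. {u, v} \<in> Es ! i)}"
      proof
        fix e assume "e \<in> \<Union> (set Es)"
        then obtain i where i: "i < s" "e \<in> Es ! i"
          using Es by (auto simp: inputs_def in_set_conv_nth)
        then have "e \<in> all_edges n"
          using Es by (auto simp: inputs_def)
        then show "e \<in> {{u, v} |u v. u < n \<and> v < n \<and> (\<exists>i<s. {u, v} \<in> Es ! i)}"
          using i by (auto simp: all_edges_def)
      qed
    qed
    finally show ?thesis .
  qed
  have "is_spanner 2 n (\<Union> (set Es)) (result ?P (transcript ?P Es (s * (n * n))))" if "Es \<in> inputs s n" for Es
    using result[OF that] is_spanner_refl by simp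
  then show ?thesis
    using valid stops by (simp add: computes_spanner_def)
qed

theorem theorem4p2:
  "\<exists>c>0. \<exists>C>0. \<exists>k::nat. \<exists>\<delta>>0. \<exists>n0::nat.
     \<forall>n\<ge>n0. \<forall>s::nat. 1 \<le> s \<and> real s \<le> \<delta> * real n \<longrightarrow>
       ereal (c * (real s * real n ^ 2) / ln (real n) ^ k)
         \<le> ereal_of_enat (spanner_comm_cost 2 s n) \<and>
       ereal_of_enat (spanner_comm_cost 2 s n)
         \<le> ereal (C * (real s * real n ^ 2) * ln (real n) ^ k)"
proof -
  \<comment> \<open>Both bounds hold with exponent 0 of the logarithm.\<close>
  have lower: "ereal (1 / 36864 * (real s * real n ^ 2) / ln (real n) ^ 0) \<le> ereal_of_enat (spanner_comm_cost 2 s n)"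
    if n: "136 \<le> n" for n s
  proof -
    let ?S = "{m. \<exists>R. computes_spanner 2 s n m R}"
    \<comment> \<open>A nonempty infimum in \<open>enat\<close> is attained, so the cost is that of
      an actual protocol.\<close>
    have "?S \<noteq> {}"
      using computes_spanner_send_all by blast
    then have "spanner_comm_cost 2 s n \<in> enat ` ?S"
      unfolding spanner_comm_cost_def Inf_enat_def
      using LeastI_ex[of "\<lambda>x. x \<in> enat ` ?S"] by auto
    then obtain m R where "spanner_comm_cost 2 s n = enat m" "computes_spanner 2 s n m R"
      by auto
    then show ?thesis
      using computes_spanner_ge[OF n] by simp
  qed
  have upper: "ereal_of_enat (spanner_comm_cost 2 s n) \<le> ereal (1 * (real s * real n ^ 2) * ln (real n) ^ 0)" for n s
  proof -
    have "spanner_comm_cost 2 s n \<le> enat (s * (n * n))"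
      unfolding spanner_comm_cost_def using computes_spanner_send_all by (intro INF_lower) blast
    then have "ereal_of_enat (spanner_comm_cost 2 s n) \<le> ereal_of_enat (enat (s * (n * n)))"
      by (simp only: ereal_of_enat_le_iff)
    then show ?thesis
      by (simp add: power2_eq_square)
  qed
  show ?thesis
    by (intro exI[of _ "1 / 36864 :: real"] exI[of _ "1 :: real"] exI[of _ "0 :: nat"] exI[of _ "136 :: nat"]
        conjI allI impI lower upper) simp_all
qed

end
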